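(* Let $(X,\mu)$ be a finite connected edge weighted graph, viewed as a topological (Hausdorff) space, and for each connected open subset $D$ of $(X,\mu)$ with $\partial D\neq\emptyset$ let $\omega_x^D$ ($x\in D$) be defined by $\omega_x^D(f):=\widetilde u(x)$ for $f:\partial D\to\mathbb R$, where $\widetilde u$ is the harmonic extension of $f$ to $D$. Then: (1) $\{\omega_\cdot^D\}$ is a harmonic measure system on $(X,\mu)$; (2) any such open set $D$ in $(X,\mu)$ is regular; (3) the harmonic measure system $\{\omega_\cdot^D\}$ is regular closed; (4) the strong maximum principle holds for any connected open set $D$ with nonempty boundary in $(X,\mu)$: if $f:\partial D\to\mathbb R$ and there is $x_0\in D$ with $\omega_{x_0}^D(f)=\sup_{x\in D}\omega_x^D(f)$, then $\omega_x^D(f)$ is constant for $x\in D$.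
   Context: Graph: $X$ is a finite set of vertices, $\mu:X\times X\to[0,\infty)$ is symmetric with zero diagonal; there is an edge between $x$ and $y$ (written $x\sim y$) iff $\mu_{xy}>0$; any two vertices are joined by a path. $(X,\mu)$ is embedded in a compact surface in a Euclidean space, and the graph (vertices together with the points of its edges) carries the induced topology; $|\cdot|$ denotes length along an edge. Open subsets $D$ considered are the connected sets $D=(X,\mu)\cap O$ with $O$ a connected open subset of the surface and $\partial D\ne\emptyset$ (boundary in the graph). Harmonic extension: inserting a new vertex $x_\lambda$ on an edge $x_1x_2$ with $|x_1x_\lambda|/|x_1x_2|=\lambda\in(0,1)$ gives the new edges the weights $\widetilde\mu(x_1,x_\lambda)=\mu(x_1,x_2)/\lambda$ and $\widetilde\mu(x_\lambda,x_2)=\mu(x_1,x_2)/(1-\lambda)$ (equivalently $\widetilde\mu(x_1,x_\lambda)/\widetilde\mu(x_\lambda,x_2)=(1-\lambda)/\lambda$ and $1/\widetilde\mu(x_1,x_\lambda)+1/\widetilde\mu(x_\lambda,x_2)=1/\mu(x_1,x_2)$). The Laplacian is $\Delta u(x)=\sum_{y\sim x}\mu(x,y)(u(x)-u(y))$ and $u$ is harmonic at $x$ if $\Delta u(x)=0$. Given $f:\partial D\to\mathbb R$, $\widetilde u$ is the continuous function on $D\cup\partial D$ with $\widetilde u=f$ on $\partial D$ that is harmonic at every point of $D$, in the following sense: it is affine in the length parameter along every segment of an edge contained in $D$, and at every vertex $v\in X\cap D$ one has $\sum_e\widetilde\mu(v,q_e)(\widetilde u(v)-\widetilde u(q_e))=0$,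 the sum being over the edges $e$ at $v$, where $q_e$ is the other vertex of $e$ if the segment of $e$ from $v$ up to it (excluding that vertex) lies in $D$, and otherwise the first point of $\partial D$ met along $e$ from $v$, and $\widetilde\mu(v,q_e)$ is $\mu_e$ divided by the proportion of the length of $e$ between $v$ and $q_e$. For a subset $A\subseteq\partial D$, $\omega_x^D(A)=\omega_x^D(\chi_A)$. Pre-harmonic measure: for $D$ open with $\partial D\neq\emptyset$, a family of Borel (outer) measures $\{\omega^D_x:2^{\partial D}\to[0,1]:x\in D\}$ such that for every connected component $V$ of $D$: $\omega_x^D(\partial V)=1$ for $x\in V$, and $\omega^D_x\ll\omega^D_y$ for $x,y\in V$ ($\omega_y^D(A)=0\Rightarrow\omega_x^D(A)=0$ for all $A$). Harmonic measure: with $\mathcal F_x=\{E\Delta N: E\subseteq\partial D\text{ Borel},\ N\subseteq\partial D,\ \omega_x^D(N)=0\}$, $\mathcal F=\bigcap_{x\in D}\mathcal F_x$, it is the restriction of a pre-harmonic measure to $\mathcal F$. $L(\partial D;\omega_\cdot^D)$ is the set of $\mathcal F$-measurable $f$ integrable with respect to every $\omega_x^D$, $x\in D$. $\omega_\cdot^D$ is continuous if $x\mapsto\omega_x^D(f)$ is continuous on $D$ for all $f\in L(\partial D;\omega_\cdot^D)$. $D$ is regular if for every $y\in\partial D$, every $f\in L(\partial D;\omega_\cdot^D)$ continuous at $y$ and every sequence $x_n\to y$ in $D$, $\omega_{x_n}^D(f)\to f(y)$. Convention: $\omega_y^D(f)=f(y)$ for $y\in\partial D$. Harmonic measure system: a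 family of continuous harmonic measures which is compatible: for any $D,\widetilde D$ in the family with $D\cap\widetilde D\ne\emptyset$, any $f\in L(\partial D;\omega_\cdot^D)$, $\widetilde f\in L(\partial\widetilde D;\omega_\cdot^{\widetilde D})$ with $\omega_y^{\widetilde D}(\widetilde f)=f(y)$ for $y\in\widetilde D\cap\partial D$ and $\omega_y^D(f)=\widetilde f(y)$ for $y\in\partial\widetilde D\cap\overline D$, one has $\omega_x^D(f)=\omega_x^{\widetilde D}(\widetilde f)$ for all $x\in D\cap\widetilde D$. It is regular closed if every $D$ in the family is the union of an increasing sequence of regular members of the family. *)

theory Defs
  imports "HOL-Analysis.Analysis"
begin

section \<open>Pre-harmonic measures and harmonic measure systems\<close>

text \<open>
  The ambient topological space is a subset \<open>G\<close> of a Hausdorff space, with the subspace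
  topology. Boundaries and closures are always taken in \<open>G\<close>.
\<close>

abbreviation bdry :: "'a::t2_space set \<Rightarrow> 'a set \<Rightarrow> 'a set" where
  "bdry G D \<equiv> top_of_set G frontier_of D"

text \<open>
  Being a Borel outer measure means that all Borel subsets of the boundary are measurable in the
  sense of Caratheodory (\<open>lambda_system\<close>). The numbers \<open>w x A\<close> are real because they lie
  in \<open>[0,1]\<close>; they are coerced to \<open>ennreal\<close> to fit the library's notions.
\<close>

definition pre_harmonic_measure ::
    "'a::t2_space set \<Rightarrow> 'a set \<Rightarrow> ('a \<Rightarrow> 'a set \<Rightarrow> real) \<Rightarrow> bool" where
  "pre_harmonic_measure G D w \<longleftrightarrow>
     openin (top_of_set G) D \<and> bdry G D \<noteq> {} \<and>
     (\<forall>x\<in>D. (\<forall>A\<subseteq>bdry G D. w x A \<in> {0..1}) \<and>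
        outer_measure_space (Pow (bdry G D)) (\<lambda>A. ennreal (w x A)) \<and>
        sets (restrict_space borel (bdry G D))
          \<subseteq> lambda_system (bdry G D) (Pow (bdry G D)) (\<lambda>A. ennreal (w x A))) \<and>
     (\<forall>V\<in>components D. \<forall>x\<in>V. w x (bdry G V) = 1 \<and>
        (\<forall>y\<in>V. \<forall>A\<subseteq>bdry G D. w y A = 0 \<longrightarrow> w x A = 0))"

definition hm_sets ::
    "'a::t2_space set \<Rightarrow> 'a set \<Rightarrow> ('a \<Rightarrow> 'a set \<Rightarrow> real) \<Rightarrow> 'a set set" where
  "hm_sets G D w =
     (\<Inter>x\<in>D. {sym_diff E N | E N.
        E \<in> sets (restrict_space borel (bdry G D)) \<and> N \<subseteq> bdry G D \<and> w x N = 0})"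

definition hm_restrict ::
    "'a::t2_space set \<Rightarrow> 'a set \<Rightarrow> ('a \<Rightarrow> 'a set \<Rightarrow> real) \<Rightarrow> 'a \<Rightarrow> 'a measure" where
  "hm_restrict G D w x = measure_of (bdry G D) (hm_sets G D w) (\<lambda>A. ennreal (w x A))"

definition harmonic_measure ::
    "'a::t2_space set \<Rightarrow> 'a set \<Rightarrow> ('a \<Rightarrow> 'a measure) \<Rightarrow> bool" where
  "harmonic_measure G D M \<longleftrightarrow>
     (\<exists>w. pre_harmonic_measure G D w \<and> (\<forall>x\<in>D. M x = hm_restrict G D w x))"

text \<open>
  All members \<open>M x\<close> of a harmonic measure have the same \<open>\<sigma>\<close>-algebra, so measurability is
  contained in \<open>integrable\<close>. Functions on the boundary are total functions of which only the
  values on the boundary matter.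
\<close>

definition hm_functions :: "'a set \<Rightarrow> ('a \<Rightarrow> 'a measure) \<Rightarrow> ('a \<Rightarrow> real) set" where
  "hm_functions D M = {f. \<forall>x\<in>D. integrable (M x) f}"

text \<open>The second branch is the convention that the value at a boundary point \<open>y\<close> is \<open>f y\<close>.\<close>

definition hm_value :: "'a set \<Rightarrow> ('a \<Rightarrow> 'a measure) \<Rightarrow> 'a \<Rightarrow> ('a \<Rightarrow> real) \<Rightarrow> real" where
  "hm_value D M x f = (if x \<in> D then integral\<^sup>L (M x) f else f x)"

definition continuous_hm :: "'a::t2_space set \<Rightarrow> ('a \<Rightarrow> 'a measure) \<Rightarrow> bool" where
  "continuous_hm D M \<longleftrightarrow>
     (\<forall>f\<in>hm_functions D M. continuous_on D (\<lambda>x. hm_value D M x f))"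

definition regular_hm ::
    "'a::t2_space set \<Rightarrow> 'a set \<Rightarrow> ('a \<Rightarrow> 'a measure) \<Rightarrow> bool" where
  "regular_hm G D M \<longleftrightarrow>
     (\<forall>y\<in>bdry G D. \<forall>f\<in>hm_functions D M. \<forall>X::nat \<Rightarrow> 'a.
        continuous (at y within bdry G D) f \<longrightarrow> range X \<subseteq> D \<longrightarrow> X \<longlonglongrightarrow> y \<longrightarrow>
        (\<lambda>n. hm_value D M (X n) f) \<longlonglongrightarrow> f y)"

definition compatible_hm ::
    "'a::t2_space set \<Rightarrow> 'a set set \<Rightarrow> ('a set \<Rightarrow> 'a \<Rightarrow> 'a measure) \<Rightarrow> bool" where
  "compatible_hm G \<D> M \<longleftrightarrow>
     (\<forall>D\<in>\<D>. \<forall>D'\<in>\<D>. D \<inter> D' \<noteq> {} \<longrightarrow>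
        (\<forall>f\<in>hm_functions D (M D). \<forall>f'\<in>hm_functions D' (M D').
           (\<forall>y\<in>D' \<inter> bdry G D. hm_value D' (M D') y f' = f y) \<longrightarrow>
           (\<forall>y\<in>bdry G D' \<inter> (top_of_set G closure_of D). hm_value D (M D) y f = f' y) \<longrightarrow>
           (\<forall>x\<in>D \<inter> D'. hm_value D (M D) x f = hm_value D' (M D') x f')))"

definition harmonic_measure_system ::
    "'a::t2_space set \<Rightarrow> 'a set set \<Rightarrow> ('a set \<Rightarrow> 'a \<Rightarrow> 'a measure) \<Rightarrow> bool" where
  "harmonic_measure_system G \<D> M \<longleftrightarrow>
     (\<forall>D\<in>\<D>. harmonic_measure G D (M D) \<and> continuous_hm D (M D)) \<and> compatible_hm G \<D> M"

definition regular_closed_hm ::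
    "'a::t2_space set \<Rightarrow> 'a set set \<Rightarrow> ('a set \<Rightarrow> 'a \<Rightarrow> 'a measure) \<Rightarrow> bool" where
  "regular_closed_hm G \<D> M \<longleftrightarrow>
     (\<forall>D\<in>\<D>. \<exists>U::nat \<Rightarrow> 'a set.
        incseq U \<and> (\<Union>n. U n) = D \<and> (\<forall>n. U n \<in> \<D> \<and> regular_hm G (U n) (M (U n))))"


section \<open>Edge weighted graphs embedded in a compact surface\<close>

text \<open>Compact two-dimensional topological manifolds (without boundary).\<close>

definition compact_surface :: "'a::euclidean_space set \<Rightarrow> bool" where
  "compact_surface S \<longleftrightarrow> compact S \<and>
     (\<forall>p\<in>S. \<exists>U (V :: (real^2) set).
        openin (top_of_set S) U \<and> p \<in> U \<and> open V \<and> U homeomorphic V)"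

text \<open>
  Length of a curve on a parameter interval: the supremum of the lengths of inscribed polygons.
\<close>

definition polygon_lengths :: "(real \<Rightarrow> 'a::metric_space) \<Rightarrow> real \<Rightarrow> real \<Rightarrow> real set" where
  "polygon_lengths g a b =
     {(\<Sum>i<n. dist (g (p i)) (g (p (Suc i)))) | (n::nat) (p::nat \<Rightarrow> real).
        mono p \<and> range p \<subseteq> {a..b}}"

definition rectifiable :: "(real \<Rightarrow> 'a::metric_space) \<Rightarrow> bool" where
  "rectifiable g \<longleftrightarrow> bdd_above (polygon_lengths g 0 1)"

definition curve_length :: "(real \<Rightarrow> 'a::metric_space) \<Rightarrow> real \<Rightarrow> real \<Rightarrow> real" where
  "curve_length g a b = Sup (polygon_lengths g a b)"

text \<open>
  The vertices of an embedded graph are identified with points of the surface. For adjacent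
  vertices \<open>x\<close>, \<open>y\<close> the curve \<open>arc_of K x y\<close> parametrises the edge from \<open>x\<close> to \<open>y\<close>, not
  necessarily with constant speed. The values of \<open>wt\<close> off the vertex set and of \<open>arc_of\<close> at
  non-adjacent pairs are irrelevant.
\<close>

record 'a embedded_graph =
  verts :: "'a set"
  wt :: "'a \<Rightarrow> 'a \<Rightarrow> real"
  arc_of :: "'a \<Rightarrow> 'a \<Rightarrow> real \<Rightarrow> 'a"

definition adj :: "'a embedded_graph \<Rightarrow> 'a \<Rightarrow> 'a \<Rightarrow> bool" where
  "adj K x y \<longleftrightarrow> x \<in> verts K \<and> y \<in> verts K \<and> wt K x y > 0"

definition finite_connected_weighted_graph :: "'a embedded_graph \<Rightarrow> bool" where
  "finite_connected_weighted_graph K \<longleftrightarrow>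
     finite (verts K) \<and>
     (\<forall>x\<in>verts K. \<forall>y\<in>verts K. wt K x y \<ge> 0 \<and> wt K x y = wt K y x) \<and>
     (\<forall>x\<in>verts K. wt K x x = 0) \<and>
     (\<forall>x\<in>verts K. \<forall>y\<in>verts K. (adj K)\<^sup>*\<^sup>* x y)"

definition embedded_in :: "'a::euclidean_space embedded_graph \<Rightarrow> 'a set \<Rightarrow> bool" where
  "embedded_in K S \<longleftrightarrow>
     verts K \<subseteq> S \<and>
     (\<forall>x y. adj K x y \<longrightarrow>
        arc (arc_of K x y) \<and> rectifiable (arc_of K x y) \<and>
        pathstart (arc_of K x y) = x \<and> pathfinish (arc_of K x y) = y \<and>
        arc_of K y x = reversepath (arc_of K x y) \<and>
        path_image (arc_of K x y) \<subseteq> S \<and>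
        path_image (arc_of K x y) \<inter> verts K = {x, y}) \<and>
     (\<forall>x y x' y'. adj K x y \<longrightarrow> adj K x' y' \<longrightarrow> {x, y} \<noteq> {x', y'} \<longrightarrow>
        path_image (arc_of K x y) \<inter> path_image (arc_of K x' y') = {x, y} \<inter> {x', y'})"

definition graph_space :: "'a::euclidean_space embedded_graph \<Rightarrow> 'a set" where
  "graph_space K = verts K \<union> (\<Union>(x, y)\<in>{(x, y). adj K x y}. path_image (arc_of K x y))"

definition graph_domains ::
    "'a::euclidean_space set \<Rightarrow> 'a embedded_graph \<Rightarrow> 'a set set" where
  "graph_domains S K =
     {D. connected D \<and>
         (\<exists>U. openin (top_of_set S) U \<and> connected U \<and> D = graph_space K \<inter> U) \<and>
         bdry (graph_space K) D \<noteq> {}}"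


section \<open>Harmonic extensions and the induced measures\<close>

text \<open>
  The parameter on the edge from \<open>v\<close> to \<open>y\<close> of the neighbour of \<open>v\<close> relative to \<open>D\<close>: the
  other vertex \<open>y\<close> if the edge without \<open>y\<close> lies in \<open>D\<close>, and otherwise the first boundary
  point met along the edge.
\<close>

definition exit_param ::
    "'a::euclidean_space embedded_graph \<Rightarrow> 'a set \<Rightarrow> 'a \<Rightarrow> 'a \<Rightarrow> real" where
  "exit_param K D v y =
     (if arc_of K v y ` {0..<1} \<subseteq> D then 1
      else (LEAST t. t \<in> {0..1} \<and> arc_of K v y t \<in> bdry (graph_space K) D))"

definition exit_point ::
    "'a::euclidean_space embedded_graph \<Rightarrow> 'a set \<Rightarrow> 'a \<Rightarrow> 'a \<Rightarrow> 'a" where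
  "exit_point K D v y = arc_of K v y (exit_param K D v y)"

text \<open>
  Inserting a vertex at the proportion \<open>\<lambda>\<close> of the length of an edge of weight \<open>\<mu>\<close> creates an
  initial segment of weight \<open>\<mu> / \<lambda>\<close>; here the inserted vertex is the exit point.
\<close>

definition exit_weight ::
    "'a::euclidean_space embedded_graph \<Rightarrow> 'a set \<Rightarrow> 'a \<Rightarrow> 'a \<Rightarrow> real" where
  "exit_weight K D v y =
     wt K v y / (curve_length (arc_of K v y) 0 (exit_param K D v y)
                 / curve_length (arc_of K v y) 0 1)"

definition harmonic_extension ::
    "'a::euclidean_space embedded_graph \<Rightarrow> 'a set \<Rightarrow> ('a \<Rightarrow> real) \<Rightarrow> ('a \<Rightarrow> real) \<Rightarrow> bool" where
  "harmonic_extension K D f u \<longleftrightarrow>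
     continuous_on (D \<union> bdry (graph_space K) D) u \<and>
     (\<forall>y\<in>bdry (graph_space K) D. u y = f y) \<and>
     (\<forall>x y I. adj K x y \<longrightarrow> is_interval I \<longrightarrow> I \<subseteq> {0..1} \<longrightarrow> arc_of K x y ` I \<subseteq> D \<longrightarrow>
        (\<exists>a b. \<forall>t\<in>I. u (arc_of K x y t) = a + b * curve_length (arc_of K x y) 0 t)) \<and>
     (\<forall>v\<in>verts K \<inter> D.
        (\<Sum>y\<in>{y. adj K v y}. exit_weight K D v y * (u v - u (exit_point K D v y))) = 0)"

text \<open>
  The functional sending \<open>f\<close> to the value at \<open>x\<close> of its harmonic extension. Extensionality makes
  the extension, a function on the closure of \<open>D\<close>, unique as a total function.
\<close>

definition omega ::
    "'a::euclidean_space embedded_graph \<Rightarrow> 'a set \<Rightarrow> 'a \<Rightarrow> ('a \<Rightarrow> real) \<Rightarrow> real" where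
  "omega K D x f =
     (THE u. u \<in> extensional (D \<union> bdry (graph_space K) D) \<and> harmonic_extension K D f u) x"

definition graph_hm ::
    "'a::euclidean_space embedded_graph \<Rightarrow> 'a set \<Rightarrow> 'a \<Rightarrow> 'a measure" where
  "graph_hm K D = hm_restrict (graph_space K) D (\<lambda>x A. omega K D x (indicator A))"

end

(* Expressing harmonicity at a vertex through the slopes of u in arc length along the outgoing
   edges makes it a local condition, independent of the domain: where a locally harmonic function
   attains its maximum over an open set W, it is constant nearby. Maximum sets are therefore open
   and relatively closed, which gives the strong maximum principle on connected sets and, since
   the graph itself is connected, the weak one on every proper open subset. Uniqueness,
   positivity and compatibility are consequences; for compatibility the weak principle is
   applied to the difference of the two extensions on the intersection of the domains, which
   need not be connected. Since a connected domain has only finitely many boundary points,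
   existence is a finite discrete Dirichlet problem on the vertices, followed by interpolation
   along the edges, and the harmonic measures are finite sums of point masses. All domains being
   regular, constant sequences show that the system is regular closed. *)

theory Submission
  imports Defs
begin

section \<open>Arc length\<close>

text \<open>Edges are parametrised with arbitrary speed, so the natural coordinate on an edge is the
  length function \<open>curve_length g 0\<close> and not the parameter. The arguments along edges
  rest on two of its properties: it is continuous, which for a supremum of polygon lengths is the
  delicate part, and strictly increasing, so that an affine function of length with an interior
  maximum has slope 0. If \<open>u\<close> has slope \<open>b\<close> along an edge from
  \<open>v\<close>, and the exit point lies at length \<open>l\<close> out of a total length
  \<open>L\<close>, then the exit weight is \<open>wt * L / l\<close> and the difference of the
  values at \<open>v\<close> and at the exit point is \<open>- b * l\<close>. The product
  \<open>- wt * L * b\<close> no longer mentions \<open>D\<close>. Finiteness of the boundary is not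
  automatic: an open subset of an edge may consist of infinitely many segments. Connectedness of
  \<open>D\<close> excludes this. Finiteness then makes every subset of the boundary Borel and every
  boundary function integrable, so that the measure theoretic conditions become statements about
  finite sums.\<close>

lemma polygon_length_le:
  assumes "rectifiable g" "mono p" "range p \<subseteq> {a..b}" "0 \<le> a" "b \<le> 1"
  shows "(\<Sum>i<n. dist (g (p i)) (g (p (Suc i)))) \<le> curve_length g a b"
proof -
  have "polygon_lengths g a b \<subseteq> polygon_lengths g 0 1"
    using assms(4,5) unfolding polygon_lengths_def by fastforce
  then have "bdd_above (polygon_lengths g a b)"
    using bdd_above_mono[OF assms(1)[unfolded rectifiable_def]] by simp
  moreover have "(\<Sum>i<n. dist (g (p i)) (g (p (Suc i)))) \<in> polygon_lengths g a b"
    using assms(2,3) unfolding polygon_lengths_def by blast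
  ultimately show ?thesis
    unfolding curve_length_def by (simp add: cSup_upper)
qed

lemma curve_length_least:
  assumes "a \<le> b"
    and "\<And>p n. mono p \<Longrightarrow> range p \<subseteq> {a..b} \<Longrightarrow> (\<Sum>i<n. dist (g (p i)) (g (p (Suc i)))) \<le> B"
  shows "curve_length g a b \<le> B"
  unfolding curve_length_def
proof (rule cSup_least)
  have "(\<Sum>i<0. dist (g a) (g a)) \<in> polygon_lengths g a b"
    unfolding polygon_lengths_def using assms(1)
    by (intro CollectI exI[of _ 0] exI[of _ "\<lambda>_. a"]) (auto simp: mono_def)
  then show "polygon_lengths g a b \<noteq> {}" by blast
qed (use assms(2) in \<open>auto simp: polygon_lengths_def\<close>)

text \<open>Clamping the vertices at \<open>b\<close> from above and from below gives one polygon on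
  each side of \<open>b\<close>; together they amount to inserting the vertex \<open>g b\<close>,
  which by the triangle inequality never shortens. Clamping avoids locating the side that crosses
  \<open>b\<close>.\<close>

lemma polygon_split:
  assumes "mono (p :: nat \<Rightarrow> real)"
  shows "(\<Sum>i<n. dist (g (p i)) (g (p (Suc i))))
    \<le> (\<Sum>i<n. dist (g (min (p i) b)) (g (min (p (Suc i)) b)))
       + (\<Sum>i<n. dist (g (max (p i) b)) (g (max (p (Suc i)) b)))"
  unfolding sum.distrib[symmetric]
proof (rule sum_mono)
  fix i
  have "p i \<le> p (Suc i)" using assms by (simp add: monoD)
  then show "dist (g (p i)) (g (p (Suc i))) \<le> dist (g (min (p i) b)) (g (min (p (Suc i)) b))
       + dist (g (max (p i) b)) (g (max (p (Suc i)) b))"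
    using dist_triangle[of "g (p i)" "g (p (Suc i))" "g b"] by (auto simp: min_def max_def)
qed

lemma dist_le_curve_length:
  assumes "rectifiable g" "0 \<le> a" "a \<le> b" "b \<le> 1"
  shows "dist (g a) (g b) \<le> curve_length g a b"
  using polygon_length_le[of g "\<lambda>i. if i = 0 then a else b" a b 1] assms
  by (auto simp: mono_def image_subset_iff)

lemma curve_length_additive:
  assumes g: "rectifiable g" and "0 \<le> a" "a \<le> b" "b \<le> c" "c \<le> 1"
  shows "curve_length g a c = curve_length g a b + curve_length g b c"
proof (rule antisym)
  show "curve_length g a c \<le> curve_length g a b + curve_length g b c"
  proof (rule curve_length_least)
    fix p :: "nat \<Rightarrow> real" and n assume p: "mono p" "range p \<subseteq> {a..c}"
    have "(\<Sum>i<n. dist (g (min (p i) b)) (g (min (p (Suc i)) b))) \<le> curve_length g a b"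
      using assms p monoD[OF p(1)]
      by (intro polygon_length_le) (auto simp: mono_def image_subset_iff min.coboundedI1 min_le_iff_disj)
    moreover have "(\<Sum>i<n. dist (g (max (p i) b)) (g (max (p (Suc i)) b))) \<le> curve_length g b c"
      using assms p monoD[OF p(1)]
      by (intro polygon_length_le) (auto simp: image_subset_iff le_max_iff_disj intro!: monoI max.mono)
    ultimately show "(\<Sum>i<n. dist (g (p i)) (g (p (Suc i)))) \<le> curve_length g a b + curve_length g b c"
      using polygon_split[OF p(1), of g n b] by linarith
  qed (use assms in auto)
next
  have *: "(\<Sum>i<n. dist (g (p i)) (g (p (Suc i)))) + (\<Sum>i<m. dist (g (q i)) (g (q (Suc i))))
      \<le> curve_length g a c"
    if p: "mono p" "range p \<subseteq> {a..b}" and q: "mono q" "range q \<subseteq> {b..c}" for p q :: "nat \<Rightarrow> real" and n m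
  proof -
    \<comment> \<open>The concatenated polygon has \<open>Suc n + m\<close> sides: the extra one
      joins \<open>p n\<close> to \<open>q 0\<close>, and its nonnegative length is dropped at the
      end.\<close>
    define r where "r i = (if i \<le> n then p i else q (i - Suc n))" for i
    have pb: "a \<le> p i" "p i \<le> b" "b \<le> q i" "q i \<le> c" for i
      using p q by (auto simp: image_subset_iff)
    have "mono r"
      unfolding mono_def r_def
    proof (intro allI impI)
      fix i j :: nat assume "i \<le> j"
      then show "(if i \<le> n then p i else q (i - Suc n)) \<le> (if j \<le> n then p j else q (j - Suc n))"
        using monoD[OF p(1), of i j] monoD[OF q(1), of "i - Suc n" "j - Suc n"]
          order_trans[OF pb(2)[of i] pb(3)[of "j - Suc n"]] by auto
    qed
    moreover have "range r \<subseteq> {a..c}"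
      unfolding r_def using pb assms
      by (auto intro: order_trans[OF pb(2)] order_trans[OF _ pb(3)])
    ultimately have le: "(\<Sum>i<Suc n + m. dist (g (r i)) (g (r (Suc i)))) \<le> curve_length g a c"
      using assms by (intro polygon_length_le) auto
    have "(\<Sum>i<Suc n + m. dist (g (r i)) (g (r (Suc i))))
       = (\<Sum>i<Suc n. dist (g (r i)) (g (r (Suc i)))) + (\<Sum>i<m. dist (g (r (Suc n + i))) (g (r (Suc (Suc n + i)))))"
      by (induction m) auto
    also have "(\<Sum>i<m. dist (g (r (Suc n + i))) (g (r (Suc (Suc n + i))))) = (\<Sum>i<m. dist (g (q i)) (g (q (Suc i))))"
      by (rule sum.cong) (auto simp: r_def)
    also have "(\<Sum>i<Suc n. dist (g (r i)) (g (r (Suc i))))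
        = (\<Sum>i<n. dist (g (p i)) (g (p (Suc i)))) + dist (g (r n)) (g (r (Suc n)))"
      by (auto simp: r_def intro!: sum.cong)
    finally have "(\<Sum>i<n. dist (g (p i)) (g (p (Suc i)))) + (\<Sum>i<m. dist (g (q i)) (g (q (Suc i))))
        \<le> (\<Sum>i<Suc n + m. dist (g (r i)) (g (r (Suc i))))"
      by simp
    with le show ?thesis by simp
  qed
  \<comment> \<open>Two suprema are taken in succession, over \<open>p\<close> for a fixed
    \<open>q\<close> and then over \<open>q\<close>.\<close>
  have "curve_length g a b \<le> curve_length g a c - (\<Sum>i<m. dist (g (q i)) (g (q (Suc i))))"
    if q: "mono q" "range q \<subseteq> {b..c}" for q :: "nat \<Rightarrow> real" and m
    by (rule curve_length_least) (use assms *[OF _ _ q] in \<open>auto simp: le_diff_eq\<close>)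
  then have "curve_length g b c \<le> curve_length g a c - curve_length g a b"
    using assms by (intro curve_length_least) (auto simp: le_diff_eq add.commute)
  then show "curve_length g a b + curve_length g b c \<le> curve_length g a c" by simp
qed

lemma curve_length_refl: "rectifiable g \<Longrightarrow> 0 \<le> a \<Longrightarrow> a \<le> 1 \<Longrightarrow> curve_length g a a = 0"
  using curve_length_additive[of g a a a] by simp

text \<open>Polygons are read backwards. One inequality is enough, because reversing twice gives
  back the curve and hence the other one.\<close>

lemma curve_length_reversepath_le:
  assumes g: "rectifiable g" and "0 \<le> a" "a \<le> b" "b \<le> 1"
  shows "curve_length (reversepath g) a b \<le> curve_length g (1 - b) (1 - a)"
proof (rule curve_length_least)
  fix p :: "nat \<Rightarrow> real" and n assume p: "mono p" "range p \<subseteq> {a..b}"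
  define q where "q i = 1 - p (n - i)" for i
  have "(\<Sum>i<n. dist (reversepath g (p i)) (reversepath g (p (Suc i))))
     = (\<Sum>i<n. dist (g (1 - p i)) (g (1 - p (Suc i))))"
    by (simp add: reversepath_def)
  also have "\<dots> = (\<Sum>i<n. dist (g (1 - p (n - Suc i))) (g (1 - p (Suc (n - Suc i)))))"
    by (rule sum.nat_diff_reindex[symmetric])
  also have "\<dots> = (\<Sum>i<n. dist (g (q i)) (g (q (Suc i))))"
    by (rule sum.cong) (auto simp: q_def Suc_diff_Suc dist_commute)
  also have "\<dots> \<le> curve_length g (1 - b) (1 - a)"
  proof (rule polygon_length_le[OF g])
    show "mono q" unfolding mono_def q_def using monoD[OF p(1)] by (simp add: diff_le_mono2)
    show "range q \<subseteq> {1 - b..1 - a}" unfolding q_def using p(2) by (auto simp: image_subset_iff)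
  qed (use assms in auto)
  finally show "(\<Sum>i<n. dist (reversepath g (p i)) (reversepath g (p (Suc i))))
    \<le> curve_length g (1 - b) (1 - a)" .
qed fact

lemma curve_length_reversepath:
  assumes g: "rectifiable g" "rectifiable (reversepath g)" and ab: "0 \<le> a" "a \<le> b" "b \<le> 1"
  shows "curve_length (reversepath g) a b = curve_length g (1 - b) (1 - a)"
  using curve_length_reversepath_le[OF g(1) ab]
    curve_length_reversepath_le[OF g(2), of "1 - b" "1 - a"] ab by simp

text \<open>A monotone sequence with two values switches at most once, so at most one side is
  nondegenerate. Such a polygon arises by clamping to an interval without vertices in its
  interior.\<close>

lemma polygon_two_points:
  assumes "mono (p :: nat \<Rightarrow> real)" "\<And>i. i \<le> n \<Longrightarrow> p i = s \<or> p i = t"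
  shows "(\<Sum>i<n. dist (g (p i)) (g (p (Suc i)))) = dist (g (p 0)) (g (p n))"
  using assms(2)
proof (induction n)
  case (Suc n)
  have IH: "(\<Sum>i<n. dist (g (p i)) (g (p (Suc i)))) = dist (g (p 0)) (g (p n))"
    using Suc by simp
  have "p 0 \<le> p n" "p n \<le> p (Suc n)" using assms(1) by (auto simp: mono_def)
  then consider "p n = p (Suc n)" | "p 0 = p n"
    using Suc.prems[of 0] Suc.prems[of n] Suc.prems[of "Suc n"] by force
  then show ?case using IH by cases auto
qed auto

text \<open>A polygon whose length is within \<open>e / 2\<close> of the total length controls all
  pieces of the curve at once: on an interval with none of its vertices in the interior, the length
  of the curve exceeds the chord by less than \<open>e / 2\<close>, because elsewhere the polygon is
  no longer than the curve. Continuity of \<open>g\<close> makes the chord small.\<close>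

lemma continuous_on_curve_length:
  assumes g: "rectifiable g" and cont: "continuous_on {0..1} g"
  shows "continuous_on {0..1} (curve_length g 0)"
  unfolding continuous_on_iff
proof (intro ballI allI impI)
  fix t e :: real assume t: "t \<in> {0..1}" and e: "e > 0"
  obtain p n where p: "mono p" "range p \<subseteq> {0..1}"
    and pn: "curve_length g 0 1 - e / 2 < (\<Sum>i<n. dist (g (p i)) (g (p (Suc i))))"
    using curve_length_least[of 0 1 g "curve_length g 0 1 - e / 2"] e by (force simp: not_le[symmetric])
  have p01: "0 \<le> p i" "p i \<le> 1" for i using p(2) by (auto simp: image_subset_iff)
  have key: "curve_length g 0 v - curve_length g 0 u < e / 2 + dist (g u) (g v)"
    if "0 \<le> u" "u \<le> v" "v \<le> 1" "\<And>i. i \<le> n \<Longrightarrow> p i \<le> u \<or> v \<le> p i" for u v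
  proof -
    \<comment> \<open>The polygon is cut at \<open>u\<close> and its upper part again at
      \<open>v\<close>; the three pieces are compared with the length up to \<open>u\<close>, the
      chord, and the length from \<open>v\<close> on.\<close>
    have m: "mono (\<lambda>i. max (p i) u)" "mono (\<lambda>i. min (p i) u)" "mono (\<lambda>i. max (max (p i) u) v)"
      "mono (\<lambda>i. min (max (p i) u) v)"
      using monoD[OF p(1)] by (auto simp: mono_def max_def min_def intro: order_trans)
    have "(\<Sum>i<n. dist (g (min (p i) u)) (g (min (p (Suc i)) u))) \<le> curve_length g 0 u"
      by (rule polygon_length_le[OF g m(2)]) (use that p01 in auto)
    moreover have "(\<Sum>i<n. dist (g (max (max (p i) u) v)) (g (max (max (p (Suc i)) u) v))) \<le> curve_length g v 1"
      by (rule polygon_length_le[OF g m(3)]) (use that p01 in auto)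
    moreover have "(\<Sum>i<n. dist (g (min (max (p i) u) v)) (g (min (max (p (Suc i)) u) v))) \<le> dist (g u) (g v)"
    proof -
      have two: "min (max (p i) u) v = u \<or> min (max (p i) u) v = v" if "i \<le> n" for i
        using \<open>u \<le> v\<close> \<open>\<And>i. i \<le> n \<Longrightarrow> p i \<le> u \<or> v \<le> p i\<close>[OF that] by auto
      show ?thesis
        using polygon_two_points[OF m(4) two, where g = g] two[of 0] two[of n]
        by (auto simp: dist_commute)
    qed
    ultimately show ?thesis
      using polygon_split[OF p(1), of g n u] polygon_split[OF m(1), of g n v] pn
        curve_length_additive[OF g, of 0 v 1] that by linarith
  qed
  obtain d1 where d1: "d1 > 0" "\<And>s. s \<in> {0..1} \<Longrightarrow> dist s t < d1 \<Longrightarrow> dist (g s) (g t) < e / 2"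
    using cont t e unfolding continuous_on_iff by (meson half_gt_zero)
  \<comment> \<open>Only the vertices different from \<open>t\<close> have to be avoided: if
    \<open>t\<close> is itself a vertex, it is an end of the interval between \<open>s\<close> and
    \<open>t\<close>.\<close>
  obtain d2 where d2: "d2 > 0" "\<And>i. i \<le> n \<Longrightarrow> p i \<noteq> t \<Longrightarrow> d2 \<le> dist t (p i)"
    using finite_set_avoid[of "p ` {..n}" t] by auto
  show "\<exists>d>0. \<forall>s\<in>{0..1}. dist s t < d \<longrightarrow> dist (curve_length g 0 s) (curve_length g 0 t) < e"
  proof (intro exI[of _ "min d1 d2"] conjI ballI impI)
    fix s :: real assume s: "s \<in> {0..1}" "dist s t < min d1 d2"
    have g1: "dist (g s) (g t) < e / 2" using d1 s by simp
    have mono: "curve_length g 0 u \<le> curve_length g 0 v" if "0 \<le> u" "u \<le> v" "v \<le> 1" for u v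
      using curve_length_additive[OF g, of 0 u v] dist_le_curve_length[OF g, of u v] that
      by (smt (verit) zero_le_dist)
    show "dist (curve_length g 0 s) (curve_length g 0 t) < e"
    proof (cases "s \<le> t")
      case True
      have "p i \<le> s \<or> t \<le> p i" if "i \<le> n" for i
        using d2(2)[OF that] s(2) by (cases "p i = t") (auto simp: dist_real_def)
      then show ?thesis
        using key[of s t] mono[of s t] s t True g1 by (auto simp: dist_real_def)
    next
      case False
      have "p i \<le> t \<or> s \<le> p i" if "i \<le> n" for i
        using d2(2)[OF that] s(2) by (cases "p i = t") (auto simp: dist_real_def)
      then show ?thesis
        using key[of t s] mono[of t s] s t False g1 by (auto simp: dist_real_def dist_commute)
    qed
  qed (use d1 d2 in auto)
qed

lemma strict_mono_on_curve_length:
  assumes g: "rectifiable g" and inj: "inj_on g {0..1}"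
  shows "strict_mono_on {0..1} (curve_length g 0)"
proof (rule strict_mono_onI)
  fix s t :: real assume st: "s \<in> {0..1}" "t \<in> {0..1}" "s < t"
  then have "g s \<noteq> g t" using inj_onD[OF inj, of s t] by auto
  then have "0 < dist (g s) (g t)" by simp
  also have "\<dots> \<le> curve_length g s t" using st by (intro dist_le_curve_length[OF g]) auto
  finally show "curve_length g 0 s < curve_length g 0 t"
    using curve_length_additive[OF g, of 0 s t] st by auto
qed

section \<open>Interpolation and the discrete Dirichlet problem\<close>

text \<open>Induction over the nodes in increasing order: beyond the largest old node
  \<open>m\<close> the interpolant is continued by the affine function of \<open>L\<close> through
  the values at \<open>m\<close> and at the new node \<open>c\<close>; strict monotonicity of
  \<open>L\<close> makes its slope meaningful. The sets \<open>I\<close> are those lying on one side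
  of every node, that is, between consecutive nodes or beyond an extreme one.\<close>

lemma piecewise_affine_interpolation:
  fixes L :: "real \<Rightarrow> real" and T :: "real set"
  assumes "finite T" "T \<subseteq> J" and L: "continuous_on J L" "strict_mono_on J L"
  shows "\<exists>h. continuous_on J h \<and> (\<forall>s\<in>T. h s = \<phi> s) \<and>
     (\<forall>I\<subseteq>J. (\<forall>s\<in>T. (\<forall>t\<in>I. t \<le> s) \<or> (\<forall>t\<in>I. s \<le> t)) \<longrightarrow> (\<exists>a b. \<forall>t\<in>I. h t = a + b * L t))"
  using assms(1,2)
proof (induction T rule: finite_linorder_max_induct)
  case empty
  show ?case by (intro exI[of _ "\<lambda>_. 0"]) (auto intro!: exI[of _ 0])
next
  case (insert c T)
  show ?case
  proof (cases "T = {}")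
    case True
    have "\<exists>a b. \<forall>t\<in>I. \<phi> c = a + b * L t" for I
      by (rule exI[of _ "\<phi> c"], rule exI[of _ 0]) simp
    with True show ?thesis by (intro exI[of _ "\<lambda>_. \<phi> c"]) auto
  next
    case False
    define m where "m = Max T"
    have m: "m \<in> T" "\<And>s. s \<in> T \<Longrightarrow> s \<le> m" "m < c" "m \<in> J" "c \<in> J"
      unfolding m_def using insert False by (auto intro: Max_in)
    obtain h where h: "continuous_on J h" "\<forall>s\<in>T. h s = \<phi> s"
      "\<And>I. I \<subseteq> J \<Longrightarrow> (\<forall>s\<in>T. (\<forall>t\<in>I. t \<le> s) \<or> (\<forall>t\<in>I. s \<le> t)) \<Longrightarrow> (\<exists>a b. \<forall>t\<in>I. h t = a + b * L t)"
      using insert by auto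
    have Lmc: "L m < L c" using L(2) m by (auto simp: strict_mono_on_def)
    define q where "q = (\<phi> c - h m) / (L c - L m)"
    define k where "k t = (if t \<le> m then h t else h m + q * (L t - L m))" for t
    have "continuous_on ({t\<in>J. t \<le> m} \<union> {t\<in>J. m \<le> t}) k"
      unfolding k_def
    proof (rule continuous_on_cases_local)
      show "closedin (top_of_set ({t \<in> J. t \<le> m} \<union> {t \<in> J. m \<le> t})) {t \<in> J. t \<le> m}"
        by (auto simp: closedin_closed intro!: exI[of _ "{..m}"])
      show "closedin (top_of_set ({t \<in> J. t \<le> m} \<union> {t \<in> J. m \<le> t})) {t \<in> J. m \<le> t}"
        by (auto simp: closedin_closed intro!: exI[of _ "{m..}"])
    qed (auto intro!: continuous_intros continuous_on_subset[OF h(1)] continuous_on_subset[OF L(1)])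
    moreover have "{t\<in>J. t \<le> m} \<union> {t\<in>J. m \<le> t} = J" by auto
    moreover have "\<forall>s\<in>insert c T. k s = \<phi> s"
      using h(2) m Lmc by (auto simp: k_def q_def)
    moreover have "\<exists>a b. \<forall>t\<in>I. k t = a + b * L t"
      if I: "I \<subseteq> J" "\<forall>s\<in>insert c T. (\<forall>t\<in>I. t \<le> s) \<or> (\<forall>t\<in>I. s \<le> t)" for I
    proof (cases "\<forall>t\<in>I. t \<le> m")
      case True
      then show ?thesis using h(3)[OF I(1)] I(2) by (auto simp: k_def)
    next
      case False
      then have "\<forall>t\<in>I. m \<le> t" using I(2) m(1) by blast
      then have "\<forall>t\<in>I. k t = (h m - q * L m) + q * L t" by (auto simp: k_def algebra_simps)
      then show ?thesis by blast
    qed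
    ultimately show ?thesis by auto
  qed
qed

text \<open>Iterating the averaging operator from a constant lower bound yields an increasing
  bounded sequence, whose limit is harmonic.\<close>

lemma discrete_dirichlet_problem:
  fixes c :: "'v \<Rightarrow> 'i \<Rightarrow> real" and q :: "'v \<Rightarrow> 'i \<Rightarrow> 'v"
  assumes "finite V" and fin: "\<And>v. v \<in> V \<Longrightarrow> finite (N v)"
    and pos: "\<And>v y. v \<in> V \<Longrightarrow> y \<in> N v \<Longrightarrow> 0 < c v y"
  shows "\<exists>u. (\<forall>v. v \<notin> V \<longrightarrow> u v = f v) \<and> (\<forall>v\<in>V. (\<Sum>y\<in>N v. c v y * (u v - u (q v y))) = 0)"
proof -
  \<comment> \<open>\<open>Q\<close> collects the points whose values enter some average; they may
    lie outside \<open>V\<close>, where the values are those of \<open>f\<close>. So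
    \<open>B\<close> bounds all the data that can enter.\<close>
  define Q where "Q = (\<Union>v\<in>V. q v ` N v)"
  define B where "B = (\<Sum>p\<in>Q. \<bar>f p\<bar>)"
  have "finite Q" using assms(1) fin by (auto simp: Q_def)
  then have B: "\<bar>f p\<bar> \<le> B" if "p \<in> Q" for p
    unfolding B_def using that by (intro member_le_sum) auto
  have B0: "0 \<le> B" by (auto simp: B_def intro: sum_nonneg)
  \<comment> \<open>For an empty \<open>N v\<close> the quotient is \<open>0 / 0 = 0\<close>, which
    respects the bound \<open>B\<close>, and the required equation is an empty sum.\<close>
  define P where "P u v = (if v \<in> V then (\<Sum>y\<in>N v. c v y * u (q v y)) / (\<Sum>y\<in>N v. c v y) else f v)"
    for u v
  define a where "a n = (P ^^ n) (\<lambda>v. if v \<in> V then - B else f v)" for n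
  have aS: "a (Suc n) = P (a n)" for n by (simp add: a_def)
  have aout: "a n v = f v" if "v \<notin> V" for n v
    using that by (cases n) (auto simp: a_def P_def)
  have csum: "0 \<le> (\<Sum>y\<in>N v. c v y)" if "v \<in> V" for v
    using pos that by (intro sum_nonneg) (auto intro: less_imp_le)
  have bound: "\<bar>a n p\<bar> \<le> B" if "p \<in> V \<union> Q" for n p
    using that
  proof (induction n arbitrary: p)
    case 0 then show ?case using B B0 by (auto simp: a_def)
  next
    case (Suc n)
    show ?case
    proof (cases "p \<in> V")
      case True
      have "\<bar>\<Sum>y\<in>N p. c p y * a n (q p y)\<bar> \<le> (\<Sum>y\<in>N p. c p y * B)"
      proof (rule order_trans[OF sum_abs], rule sum_mono)
        fix y assume y: "y \<in> N p"
        have "\<bar>a n (q p y)\<bar> \<le> B" using True y by (intro Suc.IH) (auto simp: Q_def)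
        then show "\<bar>c p y * a n (q p y)\<bar> \<le> c p y * B"
          using pos[OF True y] by (simp add: abs_mult)
      qed
      also have "\<dots> = B * (\<Sum>y\<in>N p. c p y)" by (simp add: sum_distrib_left mult.commute)
      finally show ?thesis
        using csum[OF True] B0 True
        by (cases "(\<Sum>y\<in>N p. c p y) = 0") (auto simp: aS P_def pos_divide_le_eq)
    next
      case False then show ?thesis using Suc.prems aout B by auto
    qed
  qed
  have inc: "a n v \<le> a (Suc n) v" for n v
  proof (induction n arbitrary: v)
    case 0
    show ?case
    proof (cases "v \<in> V")
      case True
      have "- B \<le> a 1 v" using bound[of v 1] True by auto
      then show ?thesis using True by (simp add: a_def)
    qed (simp add: aout)
  next
    case (Suc n)
    have "P (a n) v \<le> P (a (Suc n)) v"
      unfolding P_def using Suc csum pos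
      by (auto intro!: divide_right_mono sum_mono mult_left_mono simp: less_imp_le)
    then show ?case by (simp only: aS)
  qed
  define u where "u v = lim (\<lambda>n. a n v)" for v
  have lim: "(\<lambda>n. a n p) \<longlonglongrightarrow> u p" if "p \<in> V \<union> Q" for p
  proof -
    have "convergent (\<lambda>n. a n p)"
      by (rule Bseq_mono_convergent)
         (use bound[OF that] inc lift_Suc_mono_le[of "\<lambda>n. a n p"] in \<open>auto intro!: BseqI'[of _ B]\<close>)
    then show ?thesis unfolding u_def by (simp add: convergent_LIMSEQ_iff)
  qed
  have "(\<Sum>y\<in>N v. c v y * (u v - u (q v y))) = 0" if v: "v \<in> V" for v
  proof -
    let ?C = "\<Sum>y\<in>N v. c v y"
    have "(\<lambda>n. a (Suc n) v) \<longlonglongrightarrow> (\<Sum>y\<in>N v. c v y * u (q v y)) / ?C"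
      unfolding aS P_def divide_inverse if_P[OF v]
      by (intro tendsto_intros lim) (use v in \<open>auto simp: Q_def\<close>)
    moreover have "(\<lambda>n. a (Suc n) v) \<longlonglongrightarrow> u v" using lim v by (intro LIMSEQ_Suc) auto
    ultimately have uv: "u v = (\<Sum>y\<in>N v. c v y * u (q v y)) / ?C" using LIMSEQ_unique by blast
    show ?thesis
    proof (cases "N v = {}")
      case False
      then have "?C > 0" using fin pos v by (intro sum_pos) auto
      then have "?C * u v = (\<Sum>y\<in>N v. c v y * u (q v y))" using uv by simp
      then show ?thesis by (simp add: right_diff_distrib sum_subtractf sum_distrib_right)
    qed auto
  qed
  moreover have "u v = f v" if "v \<notin> V" for v using aout[OF that] by (simp add: u_def)
  ultimately show ?thesis by blast
qed

section \<open>The topology of an embedded graph\<close>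

locale embedded_network =
  fixes K :: "'a::euclidean_space embedded_graph" and S :: "'a set"
  assumes network: "finite_connected_weighted_graph K"
    and embedded: "embedded_in K S"
begin

abbreviation "G \<equiv> graph_space K"
abbreviation "edge \<equiv> arc_of K"
abbreviation len :: "'a \<Rightarrow> 'a \<Rightarrow> real \<Rightarrow> real" where
  "len x y \<equiv> curve_length (arc_of K x y) 0"

lemma finite_verts: "finite (verts K)"
  using network by (simp add: finite_connected_weighted_graph_def)

lemma adj_verts: "adj K x y \<Longrightarrow> x \<in> verts K" "adj K x y \<Longrightarrow> y \<in> verts K"
  by (auto simp: adj_def)

lemma wt_pos: "adj K x y \<Longrightarrow> wt K x y > 0"
  by (auto simp: adj_def)

lemma finite_neighbours: "finite {y. adj K x y}"
  by (rule finite_subset[OF _ finite_verts]) (auto simp: adj_def)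

lemma finite_edges: "finite {(x, y). adj K x y}"
  by (rule finite_subset[of _ "verts K \<times> verts K"]) (auto simp: adj_def finite_verts)

lemma adj_sym: "adj K x y \<Longrightarrow> adj K y x"
  using network by (auto simp: finite_connected_weighted_graph_def adj_def)

lemma adj_neq: "adj K x y \<Longrightarrow> x \<noteq> y"
  using network by (auto simp: finite_connected_weighted_graph_def adj_def)

lemma
  assumes "adj K x y"
  shows arc_edge: "arc (edge x y)"
    and rectifiable_edge: "rectifiable (edge x y)"
    and edge_0: "edge x y 0 = x"
    and edge_1: "edge x y 1 = y"
    and edge_reversepath: "edge y x = reversepath (edge x y)"
    and edge_inter_verts: "path_image (edge x y) \<inter> verts K = {x, y}"
  using assms embedded unfolding embedded_in_def pathstart_def pathfinish_def by blast+

lemma edge_flip: "adj K x y \<Longrightarrow> edge y x t = edge x y (1 - t)"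
  using edge_reversepath[of x y] by (simp add: reversepath_def)

lemma continuous_on_edge: "adj K x y \<Longrightarrow> continuous_on {0..1} (edge x y)"
  and inj_on_edge: "adj K x y \<Longrightarrow> inj_on (edge x y) {0..1}"
  using arc_edge[of x y] by (auto simp: arc_def path_def)

lemma len_flip:
  assumes "adj K x y" "0 \<le> t" "t \<le> 1"
  shows "len y x t = len x y 1 - len x y (1 - t)"
proof -
  have "len y x t = curve_length (edge x y) (1 - t) 1"
    using curve_length_reversepath[OF rectifiable_edge[OF assms(1)], of 0 t]
      rectifiable_edge[OF adj_sym[OF assms(1)]] assms
    by (simp add: edge_reversepath[OF assms(1)])
  then show ?thesis
    using curve_length_additive[OF rectifiable_edge[OF assms(1)], of 0 "1 - t" 1] assms by simp
qed

lemma len_0: "adj K x y \<Longrightarrow> len x y 0 = 0"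
  using curve_length_refl[OF rectifiable_edge] by simp

lemma continuous_on_len: "adj K x y \<Longrightarrow> continuous_on {0..1} (len x y)"
  by (intro continuous_on_curve_length rectifiable_edge continuous_on_edge)

lemma strict_mono_on_len: "adj K x y \<Longrightarrow> strict_mono_on {0..1} (len x y)"
  by (intro strict_mono_on_curve_length rectifiable_edge inj_on_edge)

lemma len_less: "adj K x y \<Longrightarrow> 0 \<le> s \<Longrightarrow> s < t \<Longrightarrow> t \<le> 1 \<Longrightarrow> len x y s < len x y t"
  using strict_mono_onD[OF strict_mono_on_len, of x y s t] by simp

lemma edge_in_G: "adj K x y \<Longrightarrow> t \<in> {0..1} \<Longrightarrow> edge x y t \<in> G"
  unfolding graph_space_def path_image_def by blast

lemma verts_in_G: "verts K \<subseteq> G"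
  unfolding graph_space_def by blast

lemma edge_in_verts:
  assumes "adj K x y" "t \<in> {0..1}" "edge x y t \<in> verts K"
  shows "t = 0 \<or> t = 1"
proof -
  have "edge x y t \<in> {x, y}"
    using edge_inter_verts[OF assms(1)] assms(2,3) unfolding path_image_def by blast
  then have "edge x y t = edge x y 0 \<or> edge x y t = edge x y 1"
    using edge_0[OF assms(1)] edge_1[OF assms(1)] by simp
  then show ?thesis
    using inj_onD[OF inj_on_edge[OF assms(1)], of t 0] inj_onD[OF inj_on_edge[OF assms(1)], of t 1]
      assms(2) by auto
qed

text \<open>Distinct edges meet only in common end vertices, so an interior point determines its
  edge, and injectivity of the arc determines the parameter up to reversal. This makes functions
  given edge by edge well defined.\<close>

lemma edge_eq_edge:
  assumes a: "adj K x y" "adj K x' y'" and t: "0 < t" "t < 1" "t' \<in> {0..1}"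
    and eq: "edge x y t = edge x' y' t'"
  shows "(x' = x \<and> y' = y \<and> t' = t) \<or> (x' = y \<and> y' = x \<and> t' = 1 - t)"
proof -
  have "{x, y} = {x', y'}"
  proof (rule ccontr)
    assume "{x, y} \<noteq> {x', y'}"
    then have "path_image (edge x y) \<inter> path_image (edge x' y') = {x, y} \<inter> {x', y'}"
      using embedded[unfolded embedded_in_def, THEN conjunct2, THEN conjunct2] a by simp
    moreover have "edge x y t \<in> path_image (edge x y)" "edge x' y' t' \<in> path_image (edge x' y')"
      using t by (simp_all add: path_image_def)
    ultimately have "edge x y t \<in> {x, y}" using eq by auto
    then show False using edge_in_verts[OF a(1), of t] t adj_verts[OF a(1)] by auto
  qed
  then consider "x' = x" "y' = y" | "x' = y" "y' = x"
    by (auto simp: doubleton_eq_iff)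
  then show ?thesis
  proof cases
    case 1
    then show ?thesis using inj_onD[OF inj_on_edge[OF a(1)], of t t'] eq t by auto
  next
    case 2
    then have "edge x y t = edge x y (1 - t')" using eq edge_flip[OF a(1)] by simp
    then show ?thesis using inj_onD[OF inj_on_edge[OF a(1)], of t "1 - t'"] t 2 by auto
  qed
qed

lemma G_cases:
  assumes "p \<in> G"
  obtains "p \<in> verts K" | x y t where "adj K x y" "0 < t" "t < 1" "p = edge x y t"
proof (cases "p \<in> verts K")
  case False
  then obtain x y t where xyt: "adj K x y" "t \<in> {0..1}" "p = edge x y t"
    using assms unfolding graph_space_def path_image_def by blast
  moreover have "t \<noteq> 0"
    using xyt(3) False edge_0[OF xyt(1)] adj_verts(1)[OF xyt(1)] by auto
  moreover have "t \<noteq> 1"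
    using xyt(3) False edge_1[OF xyt(1)] adj_verts(2)[OF xyt(1)] by auto
  ultimately have "0 < t" "t < 1" by simp_all
  then show ?thesis using that(2) xyt(1,3) by blast
qed (rule that(1))

section \<open>The topology of the graph read off from its edges\<close>

lemma openin_edge:
  assumes "openin (top_of_set G) W" "adj K x y" "t \<in> {0..1}" "edge x y t \<in> W"
  shows "\<exists>e>0. \<forall>s\<in>{0..1}. \<bar>s - t\<bar> < e \<longrightarrow> edge x y s \<in> W"
proof -
  obtain O' where O': "open O'" "W = G \<inter> O'" using assms(1) unfolding openin_open by blast
  have "openin (top_of_set {0..1}) ({0..1} \<inter> edge x y -` O')"
    by (rule continuous_openin_preimage_gen[OF continuous_on_edge[OF assms(2)] O'(1)])
  moreover have "t \<in> {0..1} \<inter> edge x y -` O'" using assms(3,4) O'(2) by simp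
  ultimately have "\<exists>e>0. ball t e \<inter> {0..1} \<subseteq> {0..1} \<inter> edge x y -` O'"
    by (rule openin_contains_ball[THEN iffD1, THEN conjunct2, THEN bspec])
  then obtain e where e: "e > 0" "ball t e \<inter> {0..1} \<subseteq> {0..1} \<inter> edge x y -` O'"
    by auto
  have "edge x y s \<in> W" if "s \<in> {0..1}" "\<bar>s - t\<bar> < e" for s
  proof -
    have "s \<in> ball t e \<inter> {0..1}" using that by (simp add: dist_real_def)
    then have "edge x y s \<in> O'" using e(2) by blast
    then show ?thesis using O'(2) edge_in_G[OF assms(2) that(1)] by simp
  qed
  then show ?thesis using e(1) by (intro exI[of _ e]) simp
qed

text \<open>The complement of \<open>Z\<close> is compact, being the union of finitely many vertices
  and finitely many continuous images of closed parameter sets. The condition is asked only for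
  \<open>t < 1\<close> because \<open>t = 1\<close> is the start of the reversed edge; later proofs
  then meet vertices only as starting points.\<close>

lemma openin_G:
  assumes Z: "Z \<subseteq> G"
    and ex: "\<And>x y t. adj K x y \<Longrightarrow> 0 \<le> t \<Longrightarrow> t < 1 \<Longrightarrow> edge x y t \<in> Z \<Longrightarrow>
       \<exists>e>0. \<forall>s\<in>{0..1}. \<bar>s - t\<bar> < e \<longrightarrow> edge x y s \<in> Z"
  shows "openin (top_of_set G) Z"
proof -
  have ex': "\<exists>e>0. \<forall>s\<in>{0..1}. \<bar>s - t\<bar> < e \<longrightarrow> edge x y s \<in> Z"
    if a: "adj K x y" and t: "t \<in> {0..1}" "edge x y t \<in> Z" for x y t
  proof (cases "t = 1")
    case True
    have "edge y x 0 \<in> Z" using True t(2) edge_flip[OF a] by simp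
    then obtain e where e: "e > 0" "\<And>s. s \<in> {0..1} \<Longrightarrow> \<bar>s\<bar> < e \<Longrightarrow> edge y x s \<in> Z"
      using ex[OF adj_sym[OF a], of 0] by auto
    have "edge x y s \<in> Z" if "s \<in> {0..1}" "\<bar>s - t\<bar> < e" for s
      using e(2)[of "1 - s"] that True edge_flip[OF a, of "1 - s"] by auto
    then show ?thesis using e(1) by blast
  qed (use ex[OF a, of t] t in auto)
  define C where "C x y = {t \<in> {0..1}. edge x y t \<notin> Z}" for x y
  have "compact (edge x y ` C x y)" if a: "adj K x y" for x y
  proof -
    have "openin (top_of_set {0..1}) {t \<in> {0..1}. edge x y t \<in> Z}"
      unfolding openin_contains_ball
    proof (intro conjI ballI)
      fix t assume "t \<in> {t \<in> {0..1}. edge x y t \<in> Z}"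
      then obtain e where "e > 0" "\<And>s. s \<in> {0..1} \<Longrightarrow> \<bar>s - t\<bar> < e \<Longrightarrow> edge x y s \<in> Z"
        using ex'[OF a, of t] by auto
      then show "\<exists>e>0. ball t e \<inter> {0..1} \<subseteq> {t \<in> {0..1}. edge x y t \<in> Z}"
        by (intro exI[of _ e]) (auto simp: dist_real_def abs_minus_commute)
    qed auto
    then obtain O' where "open O'" "{t \<in> {0..1}. edge x y t \<in> Z} = {0..1} \<inter> O'"
      unfolding openin_open by blast
    moreover from this(2) have "C x y = {0..1} - O'" unfolding C_def by blast
    ultimately have "compact (C x y)" by (simp add: compact_diff)
    moreover have "continuous_on (C x y) (edge x y)"
      by (rule continuous_on_subset[OF continuous_on_edge[OF a]]) (auto simp: C_def)
    ultimately show ?thesis by (rule compact_continuous_image[rotated])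
  qed
  then have "compact ((verts K - Z) \<union> (\<Union>(x, y)\<in>{(x, y). adj K x y}. edge x y ` C x y))"
    using finite_edges finite_verts
    by (intro compact_Un compact_UN) (auto intro: finite_imp_compact)
  moreover have "(verts K - Z) \<union> (\<Union>(x, y)\<in>{(x, y). adj K x y}. edge x y ` C x y) = G - Z"
    unfolding graph_space_def path_image_def C_def by auto
  ultimately have "closedin (top_of_set G) (G - Z)"
    by (intro closed_subset compact_imp_closed) auto
  then show ?thesis using Z openin_closedin[of Z "top_of_set G"] by fastforce
qed

lemma openin_open_edge:
  assumes a: "adj K x y" and "0 \<le> a" "b \<le> 1"
  shows "openin (top_of_set G) (edge x y ` {a<..<b})"
proof (rule openin_G)
  show "edge x y ` {a<..<b} \<subseteq> G" using edge_in_G[OF a] assms by auto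
next
  fix x' y' t assume a': "adj K x' y'" and t: "0 \<le> t" "t < 1" "edge x' y' t \<in> edge x y ` {a<..<b}"
  then obtain s where s: "a < s" "s < b" "edge x' y' t = edge x y s" by auto
  then consider "x' = x" "y' = y" "t = s" | "x' = y" "y' = x" "t = 1 - s"
    using edge_eq_edge[OF a a', of s t] t(1,2) assms by auto
  then show "\<exists>e>0. \<forall>r\<in>{0..1}. \<bar>r - t\<bar> < e \<longrightarrow> edge x' y' r \<in> edge x y ` {a<..<b}"
  proof cases
    case 1
    then show ?thesis using s
      by (intro exI[of _ "min (s - a) (b - s)"]) (auto intro!: imageI)
  next
    case 2
    have "edge x' y' r \<in> edge x y ` {a<..<b}" if "\<bar>r - t\<bar> < min (s - a) (b - s)" for r
      using that 2 s edge_flip[OF a, of r] by (intro image_eqI[of _ _ "1 - r"]) auto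
    then show ?thesis using s by (intro exI[of _ "min (s - a) (b - s)"]) auto
  qed
qed

lemma compact_G: "compact G"
  unfolding graph_space_def using finite_verts finite_edges arc_edge
  by (intro compact_Un compact_UN) (auto intro: compact_path_image arc_imp_path finite_imp_compact)

lemma connected_G: "connected G"
proof -
  have sub: "path_image (edge x y) \<subseteq> G" "connected (path_image (edge x y))" if "adj K x y" for x y
    using that arc_edge[OF that]
    by (auto simp: graph_space_def intro: connected_path_image arc_imp_path)
  have ends: "x \<in> path_image (edge x y)" "y \<in> path_image (edge x y)" if "adj K x y" for x y
    using edge_0[OF that] edge_1[OF that] by (auto simp: path_image_def intro: image_eqI[of _ _ 0] image_eqI[of _ _ 1])
  have *: "connected_component G x y" if "(adj K)\<^sup>*\<^sup>* x y" "x \<in> verts K" for x y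
    using that
  proof (induction rule: rtranclp_induct)
    case base
    then show ?case using verts_in_G by (auto simp: connected_component_refl_eq)
  next
    case (step y z)
    have "connected_component G y z"
      unfolding connected_component_def using sub[OF step(2)] ends[OF step(2)] by blast
    then show ?case using step by (meson connected_component_trans)
  qed
  have "connected_component G p v" if "p \<in> G" "v \<in> verts K" for p v
    using that(1)
  proof (cases rule: G_cases)
    case 1
    then show ?thesis
      using * network that(2) unfolding finite_connected_weighted_graph_def by blast
  next
    case (2 x y t)
    have "connected_component G p x"
      unfolding connected_component_def using 2 sub[OF 2(1)] ends[OF 2(1)]
      by (intro exI[of _ "path_image (edge x y)"]) (auto simp: path_image_def)
    moreover have "connected_component G x v"
      using * network adj_verts(1)[OF 2(1)] that(2) unfolding finite_connected_weighted_graph_def by blast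
    ultimately show ?thesis by (rule connected_component_trans)
  qed
  moreover have "verts K \<noteq> {}" if "G \<noteq> {}"
    using that unfolding graph_space_def adj_def by auto
  ultimately have "connected_component G p q" if "p \<in> G" "q \<in> G" for p q
    using that connected_component_trans[OF _ connected_component_sym] by blast
  then show ?thesis unfolding connected_iff_connected_component by blast
qed

text \<open>Pasting over finitely many closed pieces, each edge being homeomorphic to its parameter
  interval.\<close>

lemma continuous_on_G:
  assumes "\<And>x y. adj K x y \<Longrightarrow> continuous_on {0..1} (\<lambda>t. u (edge x y t) :: real)"
  shows "continuous_on G u"
proof -
  have "continuous_on (path_image (edge x y)) u" if a: "adj K x y" for x y
  proof -
    obtain h where "homeomorphism {0..1} (path_image (edge x y)) (edge x y) h"
      using homeomorphism_arc[OF arc_edge[OF a]] by blast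
    then have h: "continuous_on (path_image (edge x y)) h" "h ` path_image (edge x y) = {0..1}"
      "\<And>p. p \<in> path_image (edge x y) \<Longrightarrow> edge x y (h p) = p"
      by (auto simp: homeomorphism_def)
    have "continuous_on (path_image (edge x y)) ((\<lambda>t. u (edge x y t)) \<circ> h)"
      using assms[OF a] h by (intro continuous_on_compose) auto
    then show ?thesis
      by (rule continuous_on_eq) (use h(3) in auto)
  qed
  then have "continuous_on (\<Union>(x, y)\<in>{(x, y). adj K x y}. path_image (edge x y)) u"
    using finite_edges arc_edge
    by (intro continuous_on_closed_Union) (auto intro!: closed_path_image arc_imp_path)
  moreover have "closed (\<Union>(x, y)\<in>{(x, y). adj K x y}. path_image (edge x y))"
    using finite_edges arc_edge by (intro closed_UN) (auto intro!: closed_path_image arc_imp_path)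
  ultimately show ?thesis
    unfolding graph_space_def using finite_verts
    by (intro continuous_on_closed_Un) (auto intro: finite_imp_closed continuous_on_finite)
qed

section \<open>Local harmonicity and maximum principles\<close>

lemma closed_G: "closed G"
  using compact_G by (rule compact_imp_closed)

lemma openin_subset_G: "openin (top_of_set G) W \<Longrightarrow> W \<subseteq> G"
  using openin_subset by fastforce

text \<open>\<open>G\<close> is closed, so relative closures are Euclidean ones. Boundaries thereby
  become \<open>closure W - W\<close>, and by compactness of \<open>G\<close> extrema over
  \<open>closure W\<close> are attained.\<close>

lemma closure_of_eq: "openin (top_of_set G) W \<Longrightarrow> top_of_set G closure_of W = closure W"
  using closed_G closure_minimal[of W G] openin_subset_G[of W]
  by (auto simp: closure_of_subtopology Int_absorb1)

lemma bdry_eq: "openin (top_of_set G) W \<Longrightarrow> bdry G W = closure W - W"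
  by (simp add: frontier_of_def closure_of_eq interior_of_openin)

lemma Un_bdry_eq: "openin (top_of_set G) W \<Longrightarrow> W \<union> bdry G W = closure W"
  using closure_subset by (auto simp: bdry_eq)

lemma compact_closure_W: "openin (top_of_set G) W \<Longrightarrow> compact (closure W)"
  by (metis compact_G compact_closure compact_imp_bounded bounded_subset openin_subset_G)

text \<open>At a vertex the condition only involves the outward slopes of \<open>u\<close> with respect to arc
  length, because \<open>exit_weight\<close> divides by the relative length up to the exit point. Hence
  harmonicity does not depend on the domain.\<close>

definition locally_harmonic :: "'a set \<Rightarrow> ('a \<Rightarrow> real) \<Rightarrow> bool" where
  "locally_harmonic W u \<longleftrightarrow>
     (\<forall>x y t. adj K x y \<longrightarrow> 0 < t \<longrightarrow> t < 1 \<longrightarrow> edge x y t \<in> W \<longrightarrow>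
        (\<exists>e>0. \<exists>a b. \<forall>s\<in>{0..1}. \<bar>s - t\<bar> < e \<longrightarrow> u (edge x y s) = a + b * len x y s)) \<and>
     (\<forall>v\<in>verts K \<inter> W. \<exists>b.
        (\<forall>y. adj K v y \<longrightarrow> (\<exists>e>0. \<forall>s\<in>{0..1}. s < e \<longrightarrow> u (edge v y s) = u v + b y * len v y s)) \<and>
        (\<Sum>y\<in>{y. adj K v y}. wt K v y * len v y 1 * b y) = 0)"

lemma locally_harmonic_edge:
  assumes "locally_harmonic W u" "adj K x y" "0 < t" "t < 1" "edge x y t \<in> W"
  obtains e a b where "e > 0"
    "\<And>s. s \<in> {0..1} \<Longrightarrow> \<bar>s - t\<bar> < e \<Longrightarrow> u (edge x y s) = a + b * len x y s"
proof -
  have "\<exists>e>0. \<exists>a b. \<forall>s\<in>{0..1}. \<bar>s - t\<bar> < e \<longrightarrow> u (edge x y s) = a + b * len x y s"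
    using assms(1)[unfolded locally_harmonic_def, THEN conjunct1] assms(2-) by simp
  then show thesis using that by blast
qed

lemma locally_harmonic_vertex:
  assumes "locally_harmonic W u" "v \<in> verts K" "v \<in> W"
  obtains b where
    "\<And>y. adj K v y \<Longrightarrow> \<exists>e>0. \<forall>s\<in>{0..1}. s < e \<longrightarrow> u (edge v y s) = u v + b y * len v y s"
    "(\<Sum>y\<in>{y. adj K v y}. wt K v y * len v y 1 * b y) = 0"
proof -
  have "\<exists>b. (\<forall>y. adj K v y \<longrightarrow> (\<exists>e>0. \<forall>s\<in>{0..1}. s < e \<longrightarrow> u (edge v y s) = u v + b y * len v y s)) \<and>
      (\<Sum>y\<in>{y. adj K v y}. wt K v y * len v y 1 * b y) = 0"
    using assms(1)[unfolded locally_harmonic_def, THEN conjunct2] assms(2-) by simp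
  then show thesis using that by blast
qed

text \<open>Two different sets are allowed because compatibility compares extensions from two
  domains on their intersection. Slopes subtract, and the balance at a vertex is linear in them with
  coefficients that do not depend on the sets.\<close>

lemma locally_harmonic_diff:
  assumes u: "locally_harmonic W u" and u': "locally_harmonic W' u'"
  shows "locally_harmonic (W \<inter> W') (\<lambda>x. u x - u' x)"
  unfolding locally_harmonic_def
proof (intro conjI allI impI ballI)
  fix x y t assume a: "adj K x y" and t: "0 < t" "t < 1" "edge x y t \<in> W \<inter> W'"
  obtain e a b where 1: "e > 0" "\<And>s. s \<in> {0..1} \<Longrightarrow> \<bar>s - t\<bar> < e \<Longrightarrow> u (edge x y s) = a + b * len x y s"
    using locally_harmonic_edge[OF u a t(1,2)] t(3) by blast
  obtain e' a' b' where 2: "e' > 0" "\<And>s. s \<in> {0..1} \<Longrightarrow> \<bar>s - t\<bar> < e' \<Longrightarrow> u' (edge x y s) = a' + b' * len x y s"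
    using locally_harmonic_edge[OF u' a t(1,2)] t(3) by blast
  have "u (edge x y s) - u' (edge x y s) = (a - a') + (b - b') * len x y s"
    if "s \<in> {0..1}" "\<bar>s - t\<bar> < min e e'" for s
    using 1(2)[of s] 2(2)[of s] that by (simp add: algebra_simps)
  moreover have "min e e' > 0" using 1(1) 2(1) by simp
  ultimately show "\<exists>e>0. \<exists>a b. \<forall>s\<in>{0..1}. \<bar>s - t\<bar> < e \<longrightarrow>
      u (edge x y s) - u' (edge x y s) = a + b * len x y s" by blast
next
  fix v assume v: "v \<in> verts K \<inter> (W \<inter> W')"
  obtain b where b: "\<And>y. adj K v y \<Longrightarrow> (\<exists>e>0. \<forall>s\<in>{0..1}. s < e \<longrightarrow> u (edge v y s) = u v + b y * len v y s)"
    "(\<Sum>y\<in>{y. adj K v y}. wt K v y * len v y 1 * b y) = 0"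
    using locally_harmonic_vertex[OF u] v by blast
  obtain b' where b': "\<And>y. adj K v y \<Longrightarrow> (\<exists>e>0. \<forall>s\<in>{0..1}. s < e \<longrightarrow> u' (edge v y s) = u' v + b' y * len v y s)"
    "(\<Sum>y\<in>{y. adj K v y}. wt K v y * len v y 1 * b' y) = 0"
    using locally_harmonic_vertex[OF u'] v by blast
  have "\<exists>e>0. \<forall>s\<in>{0..1}. s < e \<longrightarrow>
      u (edge v y s) - u' (edge v y s) = u v - u' v + (b y - b' y) * len v y s" if a: "adj K v y" for y
  proof -
    obtain e e' where "e > 0" "\<And>s. s \<in> {0..1} \<Longrightarrow> s < e \<Longrightarrow> u (edge v y s) = u v + b y * len v y s"
      "e' > 0" "\<And>s. s \<in> {0..1} \<Longrightarrow> s < e' \<Longrightarrow> u' (edge v y s) = u' v + b' y * len v y s"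
      using b(1)[OF a] b'(1)[OF a] by blast
    then show ?thesis by (intro exI[of _ "min e e'"]) (simp add: algebra_simps)
  qed
  moreover have "(\<Sum>y\<in>{y. adj K v y}. wt K v y * len v y 1 * (b y - b' y)) = 0"
    using b(2) b'(2) by (simp add: right_diff_distrib sum_subtractf)
  ultimately show "\<exists>b. (\<forall>y. adj K v y \<longrightarrow> (\<exists>e>0. \<forall>s\<in>{0..1}. s < e \<longrightarrow>
        u (edge v y s) - u' (edge v y s) = u v - u' v + b y * len v y s)) \<and>
      (\<Sum>y\<in>{y. adj K v y}. wt K v y * len v y 1 * b y) = 0"
    by (intro exI[of _ "\<lambda>y. b y - b' y"]) blast
qed

text \<open>Inside an edge, an affine function of length that is maximal at an interior point has
  slope 0. At a vertex, maximality makes all outward slopes nonpositive, and their sum with positive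
  coefficients vanishes only if each of them is 0.\<close>

lemma openin_max_set:
  assumes W: "openin (top_of_set G) W" and u: "locally_harmonic W u" and le: "\<And>x. x \<in> W \<Longrightarrow> u x \<le> c"
  shows "openin (top_of_set G) {x \<in> W. u x = c}"
proof (rule openin_G)
  show "{x \<in> W. u x = c} \<subseteq> G" using openin_subset_G[OF W] by auto
next
  fix x y t assume a: "adj K x y" and t: "0 \<le> t" "t < 1" "edge x y t \<in> {x \<in> W. u x = c}"
  obtain d where d: "d > 0" "\<And>s. s \<in> {0..1} \<Longrightarrow> \<bar>s - t\<bar> < d \<Longrightarrow> edge x y s \<in> W"
    using openin_edge[OF W a, of t] t by auto
  have "\<exists>e>0. \<forall>s\<in>{0..1}. \<bar>s - t\<bar> < e \<longrightarrow> u (edge x y s) = c"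
  proof (cases "t = 0")
    case False
    then obtain e a' b where e: "e > 0"
      and eq: "\<And>s. s \<in> {0..1} \<Longrightarrow> \<bar>s - t\<bar> < e \<Longrightarrow> u (edge x y s) = a' + b * len x y s"
      using locally_harmonic_edge[OF u a, of t] t False by auto
    define r where "r = min (min e d) (min t (1 - t)) / 2"
    have r: "r > 0" "r < e" "r < d" "r < t" "r < 1 - t" using e d(1) t False by (auto simp: r_def)
    have "u (edge x y (t - r)) \<le> c" "u (edge x y (t + r)) \<le> c"
      using r t by (auto intro!: le d(2))
    moreover have "u (edge x y (t - r)) = a' + b * len x y (t - r)"
      "u (edge x y (t + r)) = a' + b * len x y (t + r)" "c = a' + b * len x y t"
      using eq[of "t - r"] eq[of "t + r"] eq[of t] r t by auto
    ultimately have "b * len x y (t - r) \<le> b * len x y t" "b * len x y (t + r) \<le> b * len x y t"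
      by auto
    moreover have "len x y (t - r) < len x y t" "len x y t < len x y (t + r)"
      using r t by (auto intro!: len_less a)
    ultimately have "b = 0" by (smt (verit) mult_less_cancel_left)
    then show ?thesis using eq \<open>c = _\<close> e by (intro exI[of _ e]) auto
  next
    case True
    then have x: "x \<in> verts K \<inter> W" "u x = c"
      using t(3) edge_0[OF a] adj_verts[OF a] by auto
    then obtain b where b: "\<And>y. adj K x y \<Longrightarrow> (\<exists>e>0. \<forall>s\<in>{0..1}. s < e \<longrightarrow> u (edge x y s) = u x + b y * len x y s)"
      "(\<Sum>y\<in>{y. adj K x y}. wt K x y * len x y 1 * b y) = 0"
      using locally_harmonic_vertex[OF u] by blast
    have bn: "b z \<le> 0" if az: "adj K x z" for z
    proof -
      obtain e where e: "e > 0" "\<And>s. s \<in> {0..1} \<Longrightarrow> s < e \<Longrightarrow> u (edge x z s) = u x + b z * len x z s"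
        using b(1)[OF az] by blast
      obtain d' where d': "d' > 0" "\<And>s. s \<in> {0..1} \<Longrightarrow> \<bar>s\<bar> < d' \<Longrightarrow> edge x z s \<in> W"
        using openin_edge[OF W az, of 0] x edge_0[OF az] by auto
      define r where "r = min (min e d') 1 / 2"
      have r: "0 < r" "r < e" "r < d'" "r < 1" using e(1) d'(1) by (auto simp: r_def)
      have "u (edge x z r) \<le> c" using r d'(2) by (intro le) auto
      then have "b z * len x z r \<le> 0" using e(2)[of r] r x by auto
      moreover have "0 < len x z r" using len_less[OF az, of 0 r] len_0[OF az] r by auto
      ultimately show "b z \<le> 0" by (simp add: mult_le_0_iff)
    qed
    have pos: "wt K x z * len x z 1 > 0" if az: "adj K x z" for z
      using wt_pos[OF az] len_less[OF az, of 0 1] len_0[OF az] by simp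
    have "(\<Sum>y\<in>{y. adj K x y}. wt K x y * len x y 1 * - b y) = 0"
      using b(2) by (simp add: sum_negf)
    then have "\<forall>y\<in>{y. adj K x y}. wt K x y * len x y 1 * - b y = 0"
      using bn pos finite_neighbours
      by (subst sum_nonneg_eq_0_iff[symmetric]) (auto simp: mult_le_0_iff less_imp_le)
    then have "b y = 0" using pos[OF a] a by auto
    then show ?thesis using b(1)[OF a] True x by auto
  qed
  then obtain e where e: "e > 0" "\<And>s. s \<in> {0..1} \<Longrightarrow> \<bar>s - t\<bar> < e \<Longrightarrow> u (edge x y s) = c" by blast
  show "\<exists>e>0. \<forall>s\<in>{0..1}. \<bar>s - t\<bar> < e \<longrightarrow> edge x y s \<in> {x \<in> W. u x = c}"
    using e d by (intro exI[of _ "min d e"]) auto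
qed

lemma weak_maximum_principle:
  assumes W: "openin (top_of_set G) W" "W \<noteq> G" and h: "locally_harmonic W h"
    and cont: "continuous_on (closure W) h" and le: "\<And>y. y \<in> bdry G W \<Longrightarrow> h y \<le> 0" and x: "x \<in> W"
  shows "h x \<le> 0"
proof (rule ccontr)
  assume hx: "\<not> h x \<le> 0"
  have "closure W \<noteq> {}" using x closure_subset by auto
  then obtain p where p: "p \<in> closure W" "\<And>z. z \<in> closure W \<Longrightarrow> h z \<le> h p"
    using continuous_attains_sup[OF compact_closure_W[OF W(1)] _ cont] by blast
  have hp: "h p > 0" using p(2)[of x] hx x closure_subset[of W] by auto
  let ?Z = "{z \<in> W. h z = h p}"
  \<comment> \<open>Boundary values are at most \<open>0 < h p\<close>, so no maximum point of
    \<open>closure W\<close> is lost by restricting to \<open>W\<close>; this makes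
    \<open>?Z\<close> closed.\<close>
  have "?Z = {z \<in> closure W. h z = h p}"
    using le hp closure_subset[of W] bdry_eq[OF W(1)] by force
  then have "closed ?Z"
    using continuous_closed_preimage_constant[OF cont] by simp
  then have "closedin (top_of_set G) ?Z"
    using openin_subset_G[OF W(1)] by (intro closed_subset) auto
  moreover have "openin (top_of_set G) ?Z"
    using p(2) closure_subset by (intro openin_max_set[OF W(1) h]) auto
  ultimately have "?Z = {} \<or> ?Z = G"
    using connected_G unfolding connected_clopen by blast
  moreover have "p \<in> ?Z" using p(1) \<open>?Z = {z \<in> closure W. h z = h p}\<close> by blast
  ultimately show False using W(2) openin_subset_G[OF W(1)] by blast
qed

lemma strong_maximum_principle:
  assumes W: "openin (top_of_set G) W" "connected W" and u: "locally_harmonic W u"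
    and cont: "continuous_on W u" and x0: "x0 \<in> W" "\<And>x. x \<in> W \<Longrightarrow> u x \<le> u x0" and x: "x \<in> W"
  shows "u x = u x0"
proof -
  let ?Z = "{z \<in> W. u z = u x0}"
  have "openin (top_of_set W) ?Z"
    using openin_subset_trans[OF openin_max_set[OF W(1) u x0(2)]] openin_subset_G[OF W(1)] by auto
  moreover have "closedin (top_of_set W) ?Z"
    using cont by (rule continuous_closedin_preimage_constant)
  ultimately have "?Z = {} \<or> ?Z = W"
    using W(2) unfolding connected_clopen by blast
  then show ?thesis using x0(1) x by blast
qed

section \<open>Harmonic extensions\<close>

text \<open>The last conclusion is what the discrete problem needs: the neighbours of a vertex in
  \<open>D\<close> are again vertices in \<open>D\<close> or boundary points, so the vertex
  conditions form a closed finite system.\<close>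

lemma exit_param:
  assumes D: "openin (top_of_set G) D" and v: "v \<in> D" and a: "adj K v y"
  shows exit_param_pos: "0 < exit_param K D v y"
    and exit_param_le_1: "exit_param K D v y \<le> 1"
    and edge_before_exit: "edge v y ` {0..<exit_param K D v y} \<subseteq> D"
    and exit_point_cases: "exit_point K D v y \<in> verts K \<inter> D \<union> bdry G D"
proof -
  define s where "s = exit_param K D v y"
  have "0 < s \<and> s \<le> 1 \<and> edge v y ` {0..<s} \<subseteq> D \<and> edge v y s \<in> verts K \<inter> D \<union> bdry G D"
  proof (cases "edge v y ` {0..<1} \<subseteq> D")
    case True
    then have "s = 1" by (simp add: s_def exit_param_def)
    have "continuous_on (closure {0..<1}) (edge v y)"
      using continuous_on_edge[OF a] by simp
    then have "edge v y ` closure {0..<1} \<subseteq> closure D"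
      by (rule image_closure_subset) (use True closure_subset in auto)
    moreover have "edge v y 1 \<in> edge v y ` closure {0..<1}" by simp
    ultimately have "y \<in> closure D" using edge_1[OF a] by auto
    then show ?thesis
      using True \<open>s = 1\<close> edge_1[OF a] adj_verts[OF a] by (auto simp: bdry_eq[OF D])
  next
    case False
    obtain O' where O': "open O'" "D = G \<inter> O'" using D unfolding openin_open by blast
    \<comment> \<open>\<open>LEAST\<close> over the reals needs an attained minimum. The parameters
      outside \<open>D\<close> form a closed set, which contains its infimum; all smaller parameters
      are mapped into \<open>D\<close>, so the infimum yields the first boundary point.\<close>
    define C where "C = {t \<in> {0..1}. edge v y t \<notin> D}"
    have "C = {0..1} \<inter> edge v y -` (- O')"
      using edge_in_G[OF a] O'(2) by (auto simp: C_def)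
    then have "closed C"
      using continuous_closed_preimage[OF continuous_on_edge[OF a], of "- O'"] O'(1) by (simp add: closed_Compl)
    moreover have "C \<noteq> {}" using False by (force simp: C_def)
    moreover have bdd: "bdd_below C" by (auto simp: C_def)
    ultimately have r: "Inf C \<in> C" using closed_contains_Inf by blast
    define r where "r = Inf C"
    have rC: "r \<in> {0..1}" "edge v y r \<notin> D" using r by (auto simp: r_def C_def)
    have least: "r \<le> t" if "t \<in> {0..1}" "edge v y t \<notin> D" for t
      unfolding r_def using that bdd by (intro cInf_lower) (auto simp: C_def)
    have r0: "r > 0" using rC edge_0[OF a] v by (cases "r = 0") auto
    have before: "edge v y ` {0..<r} \<subseteq> D" using least rC(1) by force
    have "continuous_on (closure {0..<r}) (edge v y)"
      using r0 rC(1) by (auto intro: continuous_on_subset[OF continuous_on_edge[OF a]])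
    then have "edge v y ` closure {0..<r} \<subseteq> closure D"
      by (rule image_closure_subset) (use before closure_subset in auto)
    then have "edge v y r \<in> bdry G D" using r0 rC by (auto simp: bdry_eq[OF D])
    moreover have "s = r"
      unfolding s_def exit_param_def if_not_P[OF False]
      by (rule Least_equality) (use rC least \<open>edge v y r \<in> bdry G D\<close> in \<open>auto simp: bdry_eq[OF D]\<close>)
    ultimately show ?thesis using r0 rC before by auto
  qed
  then show "0 < exit_param K D v y" "exit_param K D v y \<le> 1"
    "edge v y ` {0..<exit_param K D v y} \<subseteq> D" "exit_point K D v y \<in> verts K \<inter> D \<union> bdry G D"
    by (auto simp: s_def exit_point_def)
qed

lemma locally_harmonic_extension:
  assumes D: "openin (top_of_set G) D" and u: "harmonic_extension K D f u"
  shows "locally_harmonic D u"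
proof -
  have cont: "continuous_on (closure D) u"
    and aff: "\<And>x y I. adj K x y \<Longrightarrow> is_interval I \<Longrightarrow> I \<subseteq> {0..1} \<Longrightarrow> edge x y ` I \<subseteq> D \<Longrightarrow>
        \<exists>a b. \<forall>t\<in>I. u (edge x y t) = a + b * len x y t"
    and vert: "\<And>v. v \<in> verts K \<inter> D \<Longrightarrow>
        (\<Sum>y\<in>{y. adj K v y}. exit_weight K D v y * (u v - u (exit_point K D v y))) = 0"
    using u unfolding harmonic_extension_def Un_bdry_eq[OF D] by blast+
  show ?thesis
    unfolding locally_harmonic_def
  proof (intro conjI allI impI ballI)
    fix x y t assume a: "adj K x y" and t: "0 < t" "t < 1" "edge x y t \<in> D"
    obtain e where e: "e > 0" "\<And>s. s \<in> {0..1} \<Longrightarrow> \<bar>s - t\<bar> < e \<Longrightarrow> edge x y s \<in> D"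
      using openin_edge[OF D a, of t] t by auto
    have "\<exists>a b. \<forall>s\<in>{0..1} \<inter> {t - e<..<t + e}. u (edge x y s) = a + b * len x y s"
      by (intro aff a is_interval_Int) (use e(2) in \<open>auto simp: is_interval_cc is_interval_oo\<close>)
    then obtain a' b where "\<And>s. s \<in> {0..1} \<inter> {t - e<..<t + e} \<Longrightarrow> u (edge x y s) = a' + b * len x y s"
      by blast
    then have "u (edge x y s) = a' + b * len x y s" if "s \<in> {0..1}" "\<bar>s - t\<bar> < e" for s
      using that by (simp add: abs_less_iff)
    with e(1) show "\<exists>e>0. \<exists>a b. \<forall>s\<in>{0..1}. \<bar>s - t\<bar> < e \<longrightarrow> u (edge x y s) = a + b * len x y s"
      by blast
  next
    fix v assume v: "v \<in> verts K \<inter> D"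
    define s where "s y = exit_param K D v y" for y
    \<comment> \<open>The exit point may lie on the boundary, so affinity is granted only on the
      half-open interval; continuity of \<open>u\<close> on \<open>closure D\<close> carries the
      formula to the exit parameter itself.\<close>
    have "\<exists>b. \<forall>t\<in>{0..s y}. u (edge v y t) = u v + b * len v y t" if a: "adj K v y" for y
    proof -
      have s: "0 < s y" "s y \<le> 1" "edge v y ` {0..<s y} \<subseteq> D"
        using exit_param_pos[OF D _ a] exit_param_le_1[OF D _ a] edge_before_exit[OF D _ a] v
        by (auto simp: s_def)
      have "{0..<s y} \<subseteq> {0..1}" using s(2) by auto
      then obtain a' b where ab: "\<And>t. t \<in> {0..<s y} \<Longrightarrow> u (edge v y t) = a' + b * len v y t"
        using aff[OF a is_interval_co _ s(3)] by blast
      have a': "a' = u v" using ab[of 0] s(1) by (simp add: len_0 edge_0 a)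
      have cl: "closure {0..<s y} = {0..s y}" using s(1) by simp
      have ce: "continuous_on {0..s y} (edge v y)" "continuous_on {0..s y} (len v y)"
        using s(2) continuous_on_subset[OF continuous_on_edge[OF a]]
          continuous_on_subset[OF continuous_on_len[OF a]] by auto
      have "edge v y ` {0..s y} \<subseteq> closure D"
        using image_closure_subset[of "{0..<s y}" "edge v y" "closure D"] ce(1) s(3) closure_subset[of D]
        unfolding cl by auto
      then have "continuous_on {0..s y} (\<lambda>t. u (edge v y t) - b * len v y t)"
        by (intro continuous_intros ce continuous_on_compose2[OF cont])
      then have "u (edge v y t) - b * len v y t = a'" if "t \<in> {0..s y}" for t
        using continuous_constant_on_closure[of "{0..<s y}" "\<lambda>t. u (edge v y t) - b * len v y t" a' t]
          ab that unfolding cl by auto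
      then have "\<forall>t\<in>{0..s y}. u (edge v y t) = u v + b * len v y t" by (auto simp: a' algebra_simps)
      then show ?thesis by blast
    qed
    then obtain b where b: "\<And>y t. adj K v y \<Longrightarrow> t \<in> {0..s y} \<Longrightarrow> u (edge v y t) = u v + b y * len v y t"
      by metis
    have s: "0 < s y" "s y \<le> 1" if "adj K v y" for y
      using exit_param_pos[OF D _ that] exit_param_le_1[OF D _ that] v by (auto simp: s_def)
    have "exit_weight K D v y * (u v - u (exit_point K D v y)) = - (wt K v y * len v y 1 * b y)"
      if a: "adj K v y" for y
    proof -
      have "0 < len v y (s y)" using len_less[OF a, of 0 "s y"] len_0[OF a] s[OF a] by simp
      moreover have "u (exit_point K D v y) = u v + b y * len v y (s y)"
        using b[OF a, of "s y"] s(1)[OF a] by (simp add: exit_point_def s_def)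
      ultimately show ?thesis
        by (simp add: exit_weight_def s_def[symmetric])
    qed
    then have "(\<Sum>y\<in>{y. adj K v y}. wt K v y * len v y 1 * b y) = 0"
      using vert[OF v] by (simp add: sum_negf)
    then show "\<exists>b. (\<forall>y. adj K v y \<longrightarrow>
          (\<exists>e>0. \<forall>s\<in>{0..1}. s < e \<longrightarrow> u (edge v y s) = u v + b y * len v y s)) \<and>
        (\<Sum>y\<in>{y. adj K v y}. wt K v y * len v y 1 * b y) = 0"
      using b s by (intro exI[of _ b] conjI allI impI) (auto intro!: exI[of _ "s _"])
  qed
qed

text \<open>Three boundary points inside an edge would trap the connected set \<open>D\<close> between two
  of them.\<close>

lemma finite_bdry_on_edge:
  assumes D: "openin (top_of_set G) D" "connected D" and a: "adj K x y"
  shows "finite {t \<in> {0..1}. edge x y t \<in> bdry G D}"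
proof -
  define F where "F = {t \<in> {0<..<1}. edge x y t \<in> bdry G D}"
  have F: "0 < t" "t < 1" "edge x y t \<in> closure D" "edge x y t \<notin> D" if "t \<in> F" for t
    using that unfolding F_def bdry_eq[OF D(1)] by simp_all
  \<comment> \<open>The end points lie outside \<open>D\<close>, so the open and the closed arc meet
    \<open>D\<close> in the same set. That set is open and closed in \<open>D\<close>, and by
    connectedness it is empty or all of \<open>D\<close>.\<close>
  have trap: "D \<inter> edge x y ` {r<..<t} = {} \<or> closure D \<subseteq> edge x y ` {r..t}"
    if rt: "r \<in> F" "t \<in> F" for r t
  proof -
    let ?A = "edge x y ` {r<..<t}" and ?B = "edge x y ` {r..t}"
    have sub: "{r..t} \<subseteq> {0..1}" using F(1,2)[OF rt(1)] F(1,2)[OF rt(2)] by auto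
    have "compact ?B"
      by (intro compact_continuous_image continuous_on_subset[OF continuous_on_edge[OF a] sub]) simp
    then have B: "closed ?B" by (rule compact_imp_closed)
    have "edge x y s \<in> ?A" if "s \<in> {r..t}" "edge x y s \<in> D" for s
    proof -
      have "s \<noteq> r" "s \<noteq> t" using that(2) F(4)[OF rt(1)] F(4)[OF rt(2)] by metis+
      then show ?thesis using that(1) by simp
    qed
    moreover have "?A \<subseteq> ?B" by (intro image_mono) auto
    ultimately have eq: "D \<inter> ?A = D \<inter> ?B" by blast
    have "openin (top_of_set G) ?A"
      using F(1,2)[OF rt(1)] F(1,2)[OF rt(2)] by (intro openin_open_edge a) auto
    with D(1) have "openin (top_of_set G) (D \<inter> ?A)" by (rule openin_Int)
    then have "openin (top_of_set D) (D \<inter> ?A)"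
      using openin_subset_G[OF D(1)] by (rule openin_subset_trans[OF _ Int_lower1])
    moreover have "closedin (top_of_set D) (D \<inter> ?A)"
      unfolding eq using B by (rule closedin_closed_Int)
    ultimately have "D \<inter> ?A = {} \<or> D \<inter> ?A = D"
      using D(2)[unfolded connected_clopen, rule_format, of "D \<inter> ?A"] by simp
    moreover have "closure D \<subseteq> ?B" if "D \<inter> ?A = D"
      using that eq B by (intro closure_minimal) blast+
    ultimately show ?thesis by blast
  qed
  \<comment> \<open>The point at \<open>t\<close> lies in \<open>closure D\<close> but off the arc
    from \<open>r\<close> to \<open>s\<close>, so the second alternative of \<open>trap\<close>
    fails for that arc, and likewise for the arc from \<open>s\<close> to \<open>t\<close>. Then a
    whole neighbourhood of the middle point misses \<open>D\<close>, although this point belongs to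
    \<open>closure D\<close>.\<close>
  have no3: False if "r < s" "s < t" and rst: "r \<in> F" "s \<in> F" "t \<in> F" for r s t
  proof -
    have inj: "edge x y p \<notin> edge x y ` {q..q'}" if "p \<in> F" "q \<in> F" "q' \<in> F" "p < q \<or> q' < p" for p q q'
    proof
      assume "edge x y p \<in> edge x y ` {q..q'}"
      then obtain z where "z \<in> {q..q'}" "edge x y p = edge x y z" by blast
      then show False
        using inj_onD[OF inj_on_edge[OF a], of p z] F(1,2)[OF that(1)] F(1)[OF that(2)] F(2)[OF that(3)]
          that(4) by auto
    qed
    have "D \<inter> edge x y ` {r<..<s} = {}"
      using trap[OF rst(1,2)] inj[OF rst(3,1,2)] F(3)[OF rst(3)] \<open>s < t\<close> by blast
    moreover have "D \<inter> edge x y ` {s<..<t} = {}"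
      using trap[OF rst(2,3)] inj[OF rst(1,2,3)] F(3)[OF rst(1)] \<open>r < s\<close> by blast
    moreover have "edge x y ` {r<..<t} = edge x y ` {r<..<s} \<union> edge x y ` {s<..<t} \<union> {edge x y s}"
    proof -
      have "{r<..<t} = {r<..<s} \<union> {s<..<t} \<union> {s}" using \<open>r < s\<close> \<open>s < t\<close> by auto
      then show ?thesis by (simp only: image_Un image_insert image_empty)
    qed
    ultimately have disj: "D \<inter> edge x y ` {r<..<t} = {}" using F(4)[OF rst(2)]
      by (simp add: Int_Un_distrib)
    have A: "openin (top_of_set G) (edge x y ` {r<..<t})"
      using F(1,2)[OF rst(1)] F(1,2)[OF rst(3)] by (intro openin_open_edge a) auto
    then obtain O' where O': "open O'" "edge x y ` {r<..<t} = G \<inter> O'"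
      unfolding openin_open by blast
    have "edge x y s \<in> edge x y ` {r<..<t}" using \<open>r < s\<close> \<open>s < t\<close> by simp
    then have "edge x y s \<in> O'" unfolding O'(2) by simp
    moreover have "O' \<inter> D = {}" using disj openin_subset_G[OF D(1)] unfolding O'(2) by blast
    ultimately show False
      using F(3)[OF rst(2)] open_Int_closure_eq_empty[OF O'(1), of D] by blast
  qed
  have "finite F"
  proof (rule ccontr)
    assume "infinite F"
    then obtain A where "card A = 3" "A \<subseteq> F"
      using infinite_arbitrarily_large[of F 3] by metis
    moreover from this(1) obtain p q r where "A = {p, q, r}" "p \<noteq> q" "q \<noteq> r" "p \<noteq> r"
      unfolding card_3_iff by metis
    ultimately have "p \<in> F" "q \<in> F" "r \<in> F" by simp_all
    moreover have "p < q \<and> q < r \<or> p < r \<and> r < q \<or> q < p \<and> p < r \<or> q < r \<and> r < p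
        \<or> r < p \<and> p < q \<or> r < q \<and> q < p"
      using \<open>p \<noteq> q\<close> \<open>q \<noteq> r\<close> \<open>p \<noteq> r\<close>
      by (cases "p < q"; cases "q < r"; cases "p < r") auto
    ultimately show False
      using no3[of p q r] no3[of p r q] no3[of q p r] no3[of q r p] no3[of r p q] no3[of r q p] by blast
  qed
  moreover have "t \<in> {0, 1} \<union> F" if "t \<in> {0..1}" "edge x y t \<in> bdry G D" for t
    using that unfolding F_def by (cases "t = 0"; cases "t = 1") simp_all
  then have "{t \<in> {0..1}. edge x y t \<in> bdry G D} \<subseteq> {0, 1} \<union> F" by blast
  ultimately show ?thesis using finite_subset[of _ "{0, 1} \<union> F"] by simp
qed

lemma finite_bdry:
  assumes D: "openin (top_of_set G) D" "connected D"
  shows "finite (bdry G D)"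
proof -
  have "bdry G D \<subseteq> verts K \<union> (\<Union>(x, y)\<in>{(x, y). adj K x y}. edge x y ` {t \<in> {0..1}. edge x y t \<in> bdry G D})"
  proof
    fix p assume p: "p \<in> bdry G D"
    then have "p \<in> G" using closure_minimal[OF openin_subset_G[OF D(1)] closed_G] bdry_eq[OF D(1)] by auto
    then show "p \<in> verts K \<union> (\<Union>(x, y)\<in>{(x, y). adj K x y}. edge x y ` {t \<in> {0..1}. edge x y t \<in> bdry G D})"
    proof (cases rule: G_cases)
      case (2 x y t)
      then have "p \<in> edge x y ` {t \<in> {0..1}. edge x y t \<in> bdry G D}" using p by auto
      with 2(1) show ?thesis by blast
    qed simp
  qed
  moreover have "finite \<dots>"
    using finite_verts finite_edges finite_bdry_on_edge[OF D] by auto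
  ultimately show ?thesis by (rule finite_subset)
qed

section \<open>Congruence, linearity and uniqueness of harmonic extensions\<close>

lemma harmonic_extension_cong:
  assumes D: "openin (top_of_set G) D" and "harmonic_extension K D f u"
    and f: "\<And>y. y \<in> bdry G D \<Longrightarrow> f y = f' y" and u: "\<And>x. x \<in> closure D \<Longrightarrow> u x = u' x"
  shows "harmonic_extension K D f' u'"
  unfolding harmonic_extension_def
proof (intro conjI ballI allI impI)
  note h = assms(2)[unfolded harmonic_extension_def Un_bdry_eq[OF D]]
  show "continuous_on (D \<union> bdry G D) u'"
    unfolding Un_bdry_eq[OF D] using h[THEN conjunct1] u by (rule continuous_on_eq)
  show "u' y = f' y" if y: "y \<in> bdry G D" for y
    using h f[OF y] u[of y] y unfolding bdry_eq[OF D] by simp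
  show "\<exists>a b. \<forall>t\<in>I. u' (edge x y t) = a + b * len x y t"
    if I: "adj K x y" "is_interval I" "I \<subseteq> {0..1}" "edge x y ` I \<subseteq> D" for x y I
  proof -
    obtain a b where "\<forall>t\<in>I. u (edge x y t) = a + b * len x y t" using h I by blast
    moreover have "u (edge x y t) = u' (edge x y t)" if "t \<in> I" for t
      using that I(4) closure_subset[of D] by (intro u) auto
    ultimately show ?thesis by (intro exI[of _ a] exI[of _ b]) simp
  qed
  show "(\<Sum>y\<in>{y. adj K v y}. exit_weight K D v y * (u' v - u' (exit_point K D v y))) = 0"
    if v: "v \<in> verts K \<inter> D" for v
  proof -
    have "u v = u' v" using v closure_subset[of D] by (intro u) auto
    moreover have "u (exit_point K D v y) = u' (exit_point K D v y)" if "adj K v y" for y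
      using exit_point_cases[OF D _ that] v closure_subset[of D] by (intro u) (auto simp: bdry_eq[OF D])
    ultimately have "(\<Sum>y\<in>{y. adj K v y}. exit_weight K D v y * (u' v - u' (exit_point K D v y)))
        = (\<Sum>y\<in>{y. adj K v y}. exit_weight K D v y * (u v - u (exit_point K D v y)))"
      by (intro sum.cong) simp_all
    also have "\<dots> = 0" using h v by blast
    finally show ?thesis .
  qed
qed

lemma harmonic_extension_sum:
  assumes "finite B" and h: "\<And>b. b \<in> B \<Longrightarrow> harmonic_extension K D (F b) (u b)"
  shows "harmonic_extension K D (\<lambda>y. \<Sum>b\<in>B. c b * F b y) (\<lambda>x. \<Sum>b\<in>B. c b * u b x)"
  unfolding harmonic_extension_def
proof (intro conjI ballI allI impI)
  note h' = h[unfolded harmonic_extension_def]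
  show "continuous_on (D \<union> bdry G D) (\<lambda>x. \<Sum>b\<in>B. c b * u b x)"
    using h' by (intro continuous_intros) blast
  show "(\<Sum>b\<in>B. c b * u b y) = (\<Sum>b\<in>B. c b * F b y)" if "y \<in> bdry G D" for y
    using h' that by (intro sum.cong) simp_all
  show "\<exists>p q. \<forall>t\<in>I. (\<Sum>b\<in>B. c b * u b (edge x y t)) = p + q * len x y t"
    if I: "adj K x y" "is_interval I" "I \<subseteq> {0..1}" "edge x y ` I \<subseteq> D" for x y I
  proof -
    have "\<forall>b\<in>B. \<exists>p q. \<forall>t\<in>I. u b (edge x y t) = p + q * len x y t" using h' I by blast
    then obtain p q where "\<And>b t. b \<in> B \<Longrightarrow> t \<in> I \<Longrightarrow> u b (edge x y t) = p b + q b * len x y t" by metis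
    then have "(\<Sum>b\<in>B. c b * u b (edge x y t)) = (\<Sum>b\<in>B. c b * p b) + (\<Sum>b\<in>B. c b * q b) * len x y t"
      if "t \<in> I" for t
      using that by (simp add: distrib_left sum.distrib sum_distrib_right mult.assoc)
    then show ?thesis by blast
  qed
  show "(\<Sum>y\<in>{y. adj K v y}. exit_weight K D v y *
      ((\<Sum>b\<in>B. c b * u b v) - (\<Sum>b\<in>B. c b * u b (exit_point K D v y)))) = 0"
    if v: "v \<in> verts K \<inter> D" for v
  proof -
    have "(\<Sum>y\<in>{y. adj K v y}. exit_weight K D v y *
          ((\<Sum>b\<in>B. c b * u b v) - (\<Sum>b\<in>B. c b * u b (exit_point K D v y))))
        = (\<Sum>y\<in>{y. adj K v y}. \<Sum>b\<in>B. c b * (exit_weight K D v y * (u b v - u b (exit_point K D v y))))"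
      by (simp add: sum_subtractf[symmetric] sum_distrib_left algebra_simps)
    also have "\<dots> = (\<Sum>b\<in>B. c b * (\<Sum>y\<in>{y. adj K v y}. exit_weight K D v y * (u b v - u b (exit_point K D v y))))"
      by (subst sum.swap) (simp add: sum_distrib_left)
    also have "\<dots> = 0" using h' v by (intro sum.neutral) simp
    finally show ?thesis .
  qed
qed

lemma harmonic_extension_const: "harmonic_extension K D (\<lambda>_. c) (\<lambda>_. c)"
proof -
  have "\<exists>a b. \<forall>t\<in>I. c = a + b * len x y t" for x y I
    by (rule exI[of _ c], rule exI[of _ 0]) simp
  then show ?thesis unfolding harmonic_extension_def by simp
qed

lemma harmonic_extension_unique:
  assumes D: "openin (top_of_set G) D" "D \<noteq> G"
    and u: "harmonic_extension K D f u" and u': "harmonic_extension K D f u'"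
    and x: "x \<in> closure D"
  shows "u x = u' x"
proof (cases "x \<in> D")
  case True
  have *: "v x - v' x \<le> 0"
    if v: "harmonic_extension K D f v" and v': "harmonic_extension K D f v'" for v v'
  proof (rule weak_maximum_principle[OF D, of "\<lambda>x. v x - v' x"])
    show "locally_harmonic D (\<lambda>x. v x - v' x)"
      using locally_harmonic_diff[OF locally_harmonic_extension[OF D(1) v]
          locally_harmonic_extension[OF D(1) v']] by simp
    show "continuous_on (closure D) (\<lambda>x. v x - v' x)"
      using v v' unfolding harmonic_extension_def Un_bdry_eq[OF D(1)] by (intro continuous_intros) auto
    show "v y - v' y \<le> 0" if "y \<in> bdry G D" for y
      using v v' that unfolding harmonic_extension_def by simp
  qed fact
  show ?thesis using *[OF u u'] *[OF u' u] by simp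
next
  case False
  then have "x \<in> bdry G D" using x by (simp add: bdry_eq[OF D(1)])
  then show ?thesis using u u' unfolding harmonic_extension_def by simp
qed

text \<open>The extension is affine between consecutive nodes, the nodes being the vertices and the
  boundary points. Each edge has two parametrisations; a linear order on the vertices selects
  one of them.\<close>

lemma harmonic_extension_exists:
  assumes D: "openin (top_of_set G) D" "connected D"
  shows "\<exists>u. harmonic_extension K D f u"
proof -
  have "exit_weight K D v y > 0" if "v \<in> D" "adj K v y" for v y
  proof -
    note s = exit_param_pos[OF D(1) that] exit_param_le_1[OF D(1) that]
    show ?thesis
      unfolding exit_weight_def
      using wt_pos[OF that(2)] len_less[OF that(2), of 0 1] len_less[OF that(2) _ s] len_0[OF that(2)]
      by simp
  qed
  \<comment> \<open>The unknowns are the values at vertices in \<open>D\<close>; everywhere else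
    \<open>U\<close> is \<open>f\<close>, so boundary nodes carry the prescribed values
    automatically.\<close>
  then have "\<exists>U. (\<forall>v. v \<notin> verts K \<inter> D \<longrightarrow> U v = f v) \<and> (\<forall>v\<in>verts K \<inter> D.
      (\<Sum>y\<in>{y. adj K v y}. exit_weight K D v y * (U v - U (exit_point K D v y))) = 0)"
    by (intro discrete_dirichlet_problem) (auto simp: finite_verts finite_neighbours)
  then obtain U where U: "\<And>v. v \<notin> verts K \<inter> D \<Longrightarrow> U v = f v"
    and U_vert: "\<And>v. v \<in> verts K \<inter> D \<Longrightarrow>
      (\<Sum>y\<in>{y. adj K v y}. exit_weight K D v y * (U v - U (exit_point K D v y))) = 0"
    by blast
  \<comment> \<open>The parameters 0 and 1 are nodes even where the end vertices lie outside
    \<open>D\<close>: prescribing \<open>U\<close> there makes the functions on adjacent edges agree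
    at common vertices, so that the glued function is continuous on all of \<open>G\<close>.\<close>
  define T where "T x y = {t \<in> {0..1}. edge x y t \<in> bdry G D} \<union> {0, 1}" for x y
  define affine_off_T where "affine_off_T x y h \<longleftrightarrow> (\<forall>I\<subseteq>{0..1}.
      (\<forall>s\<in>T x y. (\<forall>t\<in>I. t \<le> s) \<or> (\<forall>t\<in>I. s \<le> t)) \<longrightarrow> (\<exists>a b. \<forall>t\<in>I. h t = a + b * len x y t))"
    for x y and h :: "real \<Rightarrow> real"
  have "\<exists>h. continuous_on {0..1} h \<and> (\<forall>s\<in>T x y. h s = U (edge x y s)) \<and> affine_off_T x y h"
    if a: "adj K x y" for x y
    unfolding affine_off_T_def
    by (rule piecewise_affine_interpolation)
      (use finite_bdry_on_edge[OF D a] continuous_on_len[OF a] strict_mono_on_len[OF a] in \<open>auto simp: T_def\<close>)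
  then obtain H where H: "\<And>x y. adj K x y \<Longrightarrow> continuous_on {0..1} (H x y)"
    "\<And>x y s. adj K x y \<Longrightarrow> s \<in> T x y \<Longrightarrow> H x y s = U (edge x y s)"
    "\<And>x y. adj K x y \<Longrightarrow> affine_off_T x y (H x y)"
    by metis
  obtain r :: "'a \<Rightarrow> nat" where r: "inj_on r (verts K)"
    using finite_imp_inj_to_nat_seg[OF finite_verts] by blast
  define h where "h x y t = (if r x < r y then H x y t else H y x (1 - t))" for x y t
  have r_neq: "r x \<noteq> r y" if "adj K x y" for x y
    using inj_onD[OF r] adj_verts[OF that] adj_neq[OF that] by blast
  have h_flip: "h y x t = h x y (1 - t)" if "adj K x y" for x y t
    using r_neq[OF that] by (simp add: h_def)
  have h_T: "h x y s = U (edge x y s)" if a: "adj K x y" and s: "s \<in> T x y" for x y s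
  proof (cases "r x < r y")
    case False
    have "1 - s \<in> T y x" using s edge_flip[OF a, of "1 - s"] by (auto simp: T_def)
    then show ?thesis using H(2)[OF adj_sym[OF a]] edge_flip[OF a, of "1 - s"] False by (simp add: h_def)
  qed (use H(2)[OF a s] in \<open>simp add: h_def\<close>)
  have h_cont: "continuous_on {0..1} (h x y)" if a: "adj K x y" for x y
  proof (cases "r x < r y")
    case True
    then have "h x y = H x y" by (simp add: h_def fun_eq_iff)
    then show ?thesis using H(1)[OF a] by simp
  next
    case False
    then have "h x y = (\<lambda>t. H y x (1 - t))" by (simp add: h_def fun_eq_iff)
    moreover have "continuous_on {0..1} (\<lambda>t. H y x (1 - t))"
      by (rule continuous_on_compose2[OF H(1)[OF adj_sym[OF a]]]) (auto intro!: continuous_intros)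
    ultimately show ?thesis by simp
  qed
  have h_affine: "affine_off_T x y (h x y)" if a: "adj K x y" for x y
  proof (cases "r x < r y")
    case True
    then have "h x y = H x y" by (simp add: h_def fun_eq_iff)
    then show ?thesis using H(3)[OF a] by simp
  next
    case False
    show ?thesis
      unfolding affine_off_T_def
    proof (intro allI impI)
      fix I assume I: "I \<subseteq> {0..1}" "\<forall>s\<in>T x y. (\<forall>t\<in>I. t \<le> s) \<or> (\<forall>t\<in>I. s \<le> t)"
      let ?I = "(\<lambda>t. 1 - t) ` I"
      have "(\<forall>t\<in>?I. t \<le> s) \<or> (\<forall>t\<in>?I. s \<le> t)" if "s \<in> T y x" for s
      proof -
        have "1 - s \<in> T x y" using that edge_flip[OF a, of s] by (auto simp: T_def)
        then have "(\<forall>t\<in>I. t \<le> 1 - s) \<or> (\<forall>t\<in>I. 1 - s \<le> t)" using I(2) by blast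
        then show ?thesis by (auto simp: algebra_simps)
      qed
      moreover have "?I \<subseteq> {0..1}" using I(1) by auto
      ultimately obtain p q where "\<forall>t\<in>?I. H y x t = p + q * len y x t"
        using H(3)[OF adj_sym[OF a]] unfolding affine_off_T_def by meson
      then have "h x y t = (p + q * len x y 1) + (- q) * len x y t" if "t \<in> I" for t
      proof -
        have "0 \<le> t" "t \<le> 1" using that I(1) by auto
        then have "len y x (1 - t) = len x y 1 - len x y t" using len_flip[OF a, of "1 - t"] by simp
        moreover have "H y x (1 - t) = p + q * len y x (1 - t)"
          using \<open>\<forall>t\<in>?I. _\<close> that by blast
        ultimately show ?thesis using False by (simp add: h_def right_diff_distrib)
      qed
      then show "\<exists>p q. \<forall>t\<in>I. h x y t = p + q * len x y t" by blast
    qed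
  qed
  \<comment> \<open>Any representation of an interior point may be chosen: two of them differ at
    most by reversal, with which \<open>h\<close> is consistent by \<open>h_flip\<close>.\<close>
  define u where "u p = (if p \<in> verts K then U p
      else SOME c. \<exists>x y t. adj K x y \<and> 0 < t \<and> t < 1 \<and> p = edge x y t \<and> c = h x y t)" for p
  have u_edge: "u (edge x y t) = h x y t" if a: "adj K x y" and t: "t \<in> {0..1}" for x y t
  proof (cases "edge x y t \<in> verts K")
    case True
    then have "t \<in> T x y" using edge_in_verts[OF a t] by (auto simp: T_def)
    then show ?thesis using h_T[OF a] True by (simp add: u_def)
  next
    case False
    then have "t \<noteq> 0" "t \<noteq> 1"
      using adj_verts[OF a] edge_0[OF a] edge_1[OF a] by auto
    then have t': "0 < t" "t < 1" using t by auto
    have "u (edge x y t) = (SOME c. \<exists>x' y' t'. adj K x' y' \<and> 0 < t' \<and> t' < 1 \<and>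
        edge x y t = edge x' y' t' \<and> c = h x' y' t')" using False by (simp add: u_def)
    also have "\<dots> = h x y t"
    proof (rule some_equality)
      show "\<exists>x' y' t'. adj K x' y' \<and> 0 < t' \<and> t' < 1 \<and> edge x y t = edge x' y' t' \<and> h x y t = h x' y' t'"
        using a t' by blast
    next
      fix c assume "\<exists>x' y' t'. adj K x' y' \<and> 0 < t' \<and> t' < 1 \<and> edge x y t = edge x' y' t' \<and> c = h x' y' t'"
      then obtain x' y' s where s: "adj K x' y'" "0 < s" "s < 1" "edge x y t = edge x' y' s" "c = h x' y' s"
        by blast
      then consider "x' = x" "y' = y" "s = t" | "x' = y" "y' = x" "s = 1 - t"
        using edge_eq_edge[OF a s(1) t' _ s(4)] s(2,3) by auto
      then show "c = h x y t" by cases (use s(5) h_flip[OF a] in auto)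
    qed
    finally show ?thesis .
  qed
  have u_nodes: "u p = U p" if "p \<in> verts K \<inter> D \<union> bdry G D" for p
  proof (cases "p \<in> verts K")
    case False
    then have p: "p \<in> bdry G D" using that by simp
    then have "p \<in> G"
      using closure_minimal[OF openin_subset_G[OF D(1)] closed_G] unfolding bdry_eq[OF D(1)] by auto
    then show ?thesis
    proof (cases rule: G_cases)
      case (2 x y t)
      then have "t \<in> T x y" using p by (simp add: T_def)
      then show ?thesis using u_edge[OF 2(1), of t] h_T[OF 2(1)] 2 by simp
    qed (use False in simp)
  qed (simp add: u_def)
  have "harmonic_extension K D f u"
    unfolding harmonic_extension_def
  proof (intro conjI ballI allI impI)
    have "continuous_on {0..1} (\<lambda>t. u (edge x y t))" if a: "adj K x y" for x y
      using h_cont[OF a] by (rule continuous_on_eq) (simp add: u_edge[OF a])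
    then have "continuous_on G u" by (rule continuous_on_G)
    then show "continuous_on (D \<union> bdry G D) u"
      unfolding Un_bdry_eq[OF D(1)]
      by (rule continuous_on_subset) (rule closure_minimal[OF openin_subset_G[OF D(1)] closed_G])
    show "u y = f y" if "y \<in> bdry G D" for y
      using u_nodes[of y] that U[of y] by (simp add: bdry_eq[OF D(1)])
    show "\<exists>a b. \<forall>t\<in>I. u (edge x y t) = a + b * len x y t"
      if a: "adj K x y" and I: "is_interval I" "I \<subseteq> {0..1}" "edge x y ` I \<subseteq> D" for x y I
    proof -
      \<comment> \<open>A node strictly between two parameters of \<open>I\<close> is neither 0 nor
        1, hence a boundary parameter; but it would lie in the interval \<open>I\<close> and thus be
        mapped into \<open>D\<close>, which is disjoint from its boundary.\<close>
      have "(\<forall>t\<in>I. t \<le> s) \<or> (\<forall>t\<in>I. s \<le> t)" if s: "s \<in> T x y" for s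
      proof (rule ccontr)
        assume "\<not> ?thesis"
        then obtain t t' where t: "t \<in> I" "t' \<in> I" "t < s" "s < t'" by (auto simp: not_le)
        then have "s \<in> I" using I(1) unfolding is_interval_1 by (meson less_imp_le)
        then have "edge x y s \<in> D" using I(3) by auto
        moreover have "edge x y s \<in> bdry G D"
        proof -
          have "0 \<le> t" "t' \<le> 1" using t(1,2) I(2) by auto
          then show ?thesis using s t(3,4) by (auto simp: T_def)
        qed
        ultimately show False by (simp add: bdry_eq[OF D(1)])
      qed
      then obtain p q where "\<forall>t\<in>I. h x y t = p + q * len x y t"
        using h_affine[OF a] I(2) unfolding affine_off_T_def by blast
      then have "\<forall>t\<in>I. u (edge x y t) = p + q * len x y t" using u_edge[OF a] I(2) by auto
      then show ?thesis by blast
    qed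
    show "(\<Sum>y\<in>{y. adj K v y}. exit_weight K D v y * (u v - u (exit_point K D v y))) = 0"
      if v: "v \<in> verts K \<inter> D" for v
      using U_vert[OF v] u_nodes exit_point_cases[OF D(1)] v by simp
  qed
  then show ?thesis by blast
qed

section \<open>Harmonic measures\<close>

context
  fixes D
  assumes D: "openin (top_of_set G) D" "connected D" "bdry G D \<noteq> {}"
begin

text \<open>The whole graph is closed and so has empty boundary. This is how
  \<open>bdry G D \<noteq> {}\<close> gives access to the weak maximum principle and to
  uniqueness.\<close>

lemma domain_neq_G: "D \<noteq> G"
  using D(3) closed_G by (auto simp: bdry_eq[OF D(1)])

lemma domain_nonempty: "D \<noteq> {}"
  using D(3) by auto

text \<open>Restriction to the closure makes any extension extensional, and uniqueness on the
  closure then becomes uniqueness as a total function; this justifies the definite description in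
  \<open>omega\<close>.\<close>

lemma harmonic_extension_omega: "harmonic_extension K D f (\<lambda>x. omega K D x f)"
proof -
  obtain u where u: "harmonic_extension K D f u" using harmonic_extension_exists[OF D(1,2)] by blast
  have "\<exists>!v. v \<in> extensional (D \<union> bdry G D) \<and> harmonic_extension K D f v"
  proof (rule ex1I)
    show "restrict u (D \<union> bdry G D) \<in> extensional (D \<union> bdry G D) \<and>
        harmonic_extension K D f (restrict u (D \<union> bdry G D))"
      using harmonic_extension_cong[OF D(1) u, of f "restrict u (D \<union> bdry G D)"]
      by (simp add: Un_bdry_eq[OF D(1)])
  next
    fix v assume "v \<in> extensional (D \<union> bdry G D) \<and> harmonic_extension K D f v"
    then show "v = restrict u (D \<union> bdry G D)"
      using harmonic_extension_unique[OF D(1) domain_neq_G _ u, of v]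
      unfolding Un_bdry_eq[OF D(1)] by (auto simp: extensional_def restrict_def fun_eq_iff)
  qed
  then show ?thesis unfolding omega_def by (rule theI'[THEN conjunct2])
qed

lemma omega_eq:
  assumes "harmonic_extension K D f u" "x \<in> closure D"
  shows "omega K D x f = u x"
  using harmonic_extension_unique[OF D(1) domain_neq_G harmonic_extension_omega assms] .

lemma omega_bdry: "y \<in> bdry G D \<Longrightarrow> omega K D y f = f y"
  using harmonic_extension_omega[of f] unfolding harmonic_extension_def by simp

lemma continuous_on_omega: "continuous_on (closure D) (\<lambda>x. omega K D x f)"
  using harmonic_extension_omega[of f] unfolding harmonic_extension_def Un_bdry_eq[OF D(1)] by simp

text \<open>On the finite boundary \<open>f\<close> is a linear combination of point indicators, and
  linearity passes to the extensions. The coefficients \<open>omega K D x (indicator {y})\<close>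
  play the role of a Poisson kernel.\<close>

lemma omega_sum:
  assumes "x \<in> closure D"
  shows "omega K D x f = (\<Sum>y\<in>bdry G D. f y * omega K D x (indicator {y}))"
proof (rule omega_eq[OF _ assms])
  have "harmonic_extension K D (\<lambda>z. \<Sum>y\<in>bdry G D. f y * indicator {y} z)
      (\<lambda>x. \<Sum>y\<in>bdry G D. f y * omega K D x (indicator {y}))"
    using finite_bdry[OF D(1,2)] harmonic_extension_omega by (rule harmonic_extension_sum)
  then show "harmonic_extension K D f (\<lambda>x. \<Sum>y\<in>bdry G D. f y * omega K D x (indicator {y}))"
  proof (rule harmonic_extension_cong[OF D(1)])
    fix z assume "z \<in> bdry G D"
    then show "(\<Sum>y\<in>bdry G D. f y * indicator {y} z) = f z"
      using finite_bdry[OF D(1,2)] by (subst sum.remove[of _ z]) (auto simp: indicator_def)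
  qed simp
qed

lemma locally_harmonic_omega: "locally_harmonic D (\<lambda>x. omega K D x f)"
  using locally_harmonic_extension[OF D(1) harmonic_extension_omega] .

lemma locally_harmonic_uminus_omega: "locally_harmonic D (\<lambda>x. - omega K D x f)"
  using locally_harmonic_diff[OF locally_harmonic_extension[OF D(1) harmonic_extension_const[of D 0]]
      locally_harmonic_omega] by simp

lemma omega_nonneg:
  assumes f: "\<And>y. y \<in> bdry G D \<Longrightarrow> 0 \<le> f y" and x: "x \<in> D"
  shows "0 \<le> omega K D x f"
proof -
  have "- omega K D x f \<le> 0"
    by (rule weak_maximum_principle[OF D(1) domain_neq_G locally_harmonic_uminus_omega])
      (use f x omega_bdry in \<open>auto intro!: continuous_intros continuous_on_omega\<close>)
  then show ?thesis by simp
qed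

lemma omega_strong_maximum:
  assumes "x0 \<in> D" "\<And>x. x \<in> D \<Longrightarrow> omega K D x f \<le> omega K D x0 f" "x \<in> D"
  shows "omega K D x f = omega K D x0 f"
  using strong_maximum_principle[OF D(1,2) locally_harmonic_omega
      continuous_on_subset[OF continuous_on_omega closure_subset] assms] .

text \<open>A nonnegative extension with a zero in \<open>D\<close> attains its minimum there, so
  the strong maximum principle for its negative makes it vanish. Applied to indicators, this is the
  absolute continuity between any two points of \<open>D\<close>.\<close>

lemma omega_eq_0:
  assumes f: "\<And>y. y \<in> bdry G D \<Longrightarrow> 0 \<le> f y" and y: "y \<in> D" "omega K D y f = 0" and x: "x \<in> D"
  shows "omega K D x f = 0"
proof -
  have "- omega K D x f = - omega K D y f"
    by (rule strong_maximum_principle[OF D(1,2) locally_harmonic_uminus_omega])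
      (use f x y omega_nonneg in \<open>auto intro!: continuous_intros continuous_on_subset[OF continuous_on_omega closure_subset]\<close>)
  then show ?thesis using y by simp
qed

section \<open>Harmonic measures as finite sums of point masses\<close>

lemma omega_indicator:
  assumes "x \<in> closure D" "A \<subseteq> bdry G D"
  shows "omega K D x (indicator A) = (\<Sum>y\<in>A. omega K D x (indicator {y}))"
proof -
  have "omega K D x (indicator A) = (\<Sum>y\<in>bdry G D. indicator A y * omega K D x (indicator {y}))"
    using omega_sum[OF assms(1)] .
  also have "\<dots> = (\<Sum>y\<in>A. omega K D x (indicator {y}))"
    using finite_bdry[OF D(1,2)] assms(2) by (intro sum.mono_neutral_cong_right) (auto simp: indicator_def)
  finally show ?thesis .
qed

text \<open>Once the set function is recognised as a measure on all subsets, the outer measure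
  axioms and the Caratheodory condition follow from monotonicity, subadditivity and additivity of
  \<open>emeasure\<close>.\<close>

lemma ennreal_omega_indicator:
  assumes "x \<in> D" "A \<subseteq> bdry G D"
  shows "ennreal (omega K D x (indicator A))
    = emeasure (point_measure (bdry G D) (\<lambda>y. ennreal (omega K D x (indicator {y})))) A"
proof -
  have "x \<in> closure D" using assms(1) closure_subset by blast
  then show ?thesis
    using finite_bdry[OF D(1,2)] assms omega_nonneg
    by (simp add: omega_indicator emeasure_point_measure_finite)
qed

lemma omega_indicator_bdry:
  assumes "x \<in> D"
  shows "omega K D x (indicator (bdry G D)) = 1"
proof (rule omega_eq)
  show "harmonic_extension K D (indicator (bdry G D)) (\<lambda>_. 1)"
    using D(1) harmonic_extension_const[of D 1] by (rule harmonic_extension_cong) auto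
qed (use assms closure_subset in blast)

lemma sets_bdry: "sets (restrict_space borel (bdry G D)) = Pow (bdry G D)"
proof -
  have "A \<in> sets (restrict_space borel (bdry G D))" if "A \<subseteq> bdry G D" for A
  proof -
    have "finite A" using that finite_bdry[OF D(1,2)] finite_subset by blast
    then have "A \<in> sets borel" by (intro borel_closed finite_imp_closed)
    then show ?thesis using that by (auto simp: sets_restrict_space Int_absorb1 intro!: image_eqI[of _ _ A])
  qed
  then show ?thesis by (auto simp: sets_restrict_space)
qed

lemma pre_harmonic_measure_omega: "pre_harmonic_measure G D (\<lambda>x A. omega K D x (indicator A))"
  unfolding pre_harmonic_measure_def
proof (intro conjI ballI allI impI)
  let ?B = "bdry G D"
  show "openin (top_of_set G) D" "?B \<noteq> {}" by fact+
  have comp: "components D = {D}" using D(2) domain_nonempty by (simp add: components_eq_sing_iff)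
  fix x assume x: "x \<in> D"
  let ?P = "point_measure ?B (\<lambda>y. ennreal (omega K D x (indicator {y})))"
  have P: "ennreal (omega K D x (indicator A)) = emeasure ?P A" if "A \<subseteq> ?B" for A
    using ennreal_omega_indicator[OF x that] .
  have sP: "sets ?P = Pow ?B" by (simp add: sets_point_measure)
  show "omega K D x (indicator A) \<in> {0..1}" if A: "A \<subseteq> ?B" for A
  proof -
    have xc: "x \<in> closure D" using x closure_subset by blast
    have "omega K D x (indicator A) \<le> omega K D x (indicator ?B)"
      unfolding omega_indicator[OF xc A] omega_indicator[OF xc order_refl]
      using finite_bdry[OF D(1,2)] A omega_nonneg[OF _ x] by (intro sum_mono2) auto
    then show ?thesis using omega_nonneg[OF _ x, of "indicator A"] omega_indicator_bdry[OF x] by simp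
  qed
  show "outer_measure_space (Pow ?B) (\<lambda>A. ennreal (omega K D x (indicator A)))"
    unfolding outer_measure_space_def positive_def increasing_def countably_subadditive_def
  proof (intro conjI ballI allI impI)
    show "ennreal (omega K D x (indicator {})) = 0" using P[of "{}"] by simp
    show "ennreal (omega K D x (indicator A)) \<le> ennreal (omega K D x (indicator A'))"
      if "A \<in> Pow ?B" "A' \<in> Pow ?B" "A \<subseteq> A'" for A A'
      using that P[of A] P[of A'] emeasure_mono[of A A' ?P] sP by simp
    show "ennreal (omega K D x (indicator (\<Union>i. A i))) \<le> (\<Sum>i. ennreal (omega K D x (indicator (A i))))"
      if "range A \<subseteq> Pow ?B" "disjoint_family A" "(\<Union>i. A i) \<in> Pow ?B" for A :: "nat \<Rightarrow> 'a set"
    proof -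
      have "\<And>i. A i \<subseteq> ?B" using that(1) by auto
      then show ?thesis
        using that emeasure_subadditive_countably[of A ?P] sP by (simp add: P UN_subset_iff)
    qed
  qed
  show "sets (restrict_space borel ?B)
      \<subseteq> lambda_system ?B (Pow ?B) (\<lambda>A. ennreal (omega K D x (indicator A)))"
    unfolding sets_bdry lambda_system_def
  proof (intro subsetI CollectI conjI ballI)
    fix A C assume A: "A \<in> Pow ?B" and C: "C \<in> Pow ?B"
    have "emeasure ?P (A \<inter> C) + emeasure ?P ((?B - A) \<inter> C) = emeasure ?P ((A \<inter> C) \<union> ((?B - A) \<inter> C))"
      using A C sP by (intro plus_emeasure) auto
    moreover have "(A \<inter> C) \<union> ((?B - A) \<inter> C) = C" using A C by blast
    moreover have "A \<inter> C \<subseteq> ?B" "(?B - A) \<inter> C \<subseteq> ?B" "C \<subseteq> ?B" using C by auto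
    ultimately show "ennreal (omega K D x (indicator (A \<inter> C))) + ennreal (omega K D x (indicator ((?B - A) \<inter> C)))
        = ennreal (omega K D x (indicator C))"
      by (simp add: P)
  qed
next
  fix V x assume V: "V \<in> components D" "x \<in> V"
  \<comment> \<open>A nonempty connected set is its own only component, so the conditions on
    components are conditions on \<open>D\<close>.\<close>
  have "components D = {D}" using D(2) domain_nonempty by (simp add: components_eq_sing_iff)
  with V have VD: "V = D" by simp
  then have x: "x \<in> D" using V by simp
  show "omega K D x (indicator (bdry G V)) = 1" using omega_indicator_bdry[OF x] VD by simp
  show "omega K D x (indicator A) = 0" if "y \<in> V" "A \<subseteq> bdry G D" "omega K D y (indicator A) = 0" for y A
    using omega_eq_0[of "indicator A" y x] that x VD by simp
qed

lemma graph_hm_eq: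
  assumes x: "x \<in> D"
  shows "graph_hm K D x = point_measure (bdry G D) (\<lambda>y. ennreal (omega K D x (indicator {y})))"
    (is "_ = ?P")
proof -
  have zero: "omega K D z (indicator {}) = 0" if "z \<in> D" for z
    using omega_indicator[of z "{}"] that closure_subset by auto
  have "hm_sets G D (\<lambda>x A. omega K D x (indicator A)) = Pow (bdry G D)"
  proof
    show "hm_sets G D (\<lambda>x A. omega K D x (indicator A)) \<subseteq> Pow (bdry G D)"
      using domain_nonempty unfolding hm_sets_def sets_bdry by blast
    \<comment> \<open>All subsets of the boundary are Borel, and the empty set serves as the null
      set for every point of \<open>D\<close>.\<close>
    show "Pow (bdry G D) \<subseteq> hm_sets G D (\<lambda>x A. omega K D x (indicator A))"
    proof
      fix A assume "A \<in> Pow (bdry G D)"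
      moreover have "A = sym_diff A {}" by simp
      ultimately show "A \<in> hm_sets G D (\<lambda>x A. omega K D x (indicator A))"
        unfolding hm_sets_def sets_bdry using zero by blast
    qed
  qed
  then have "graph_hm K D x = measure_of (bdry G D) (Pow (bdry G D)) (\<lambda>A. ennreal (omega K D x (indicator A)))"
    unfolding graph_hm_def hm_restrict_def by simp
  also have "\<dots> = measure_of (space ?P) (sets ?P) (emeasure ?P)"
    unfolding space_point_measure sets_point_measure
    by (rule measure_of_eq) (simp_all add: sigma_algebra.sigma_sets_eq[OF sigma_algebra_Pow] ennreal_omega_indicator[OF x])
  also have "\<dots> = ?P" by (rule measure_of_of_measure)
  finally show ?thesis .
qed

lemma hm_functions_graph_hm: "hm_functions D (graph_hm K D) = UNIV"
  using finite_bdry[OF D(1,2)]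
  by (auto simp: hm_functions_def graph_hm_eq integrable_point_measure_finite)

lemma integral_graph_hm:
  assumes x: "x \<in> D"
  shows "integral\<^sup>L (graph_hm K D x) f = omega K D x f"
proof -
  have "x \<in> closure D" using x closure_subset by blast
  then show ?thesis
    using finite_bdry[OF D(1,2)] omega_nonneg[OF _ x]
    by (simp add: graph_hm_eq[OF x] lebesgue_integral_point_measure_finite omega_sum[of x f] mult.commute)
qed

lemma hm_value_graph_hm: "x \<in> closure D \<Longrightarrow> hm_value D (graph_hm K D) x f = omega K D x f"
  using omega_bdry[of x f] by (auto simp: hm_value_def integral_graph_hm bdry_eq[OF D(1)])

lemma harmonic_measure_graph_hm: "harmonic_measure G D (graph_hm K D)"
  unfolding harmonic_measure_def graph_hm_def using pre_harmonic_measure_omega by blast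

lemma continuous_hm_graph_hm: "continuous_hm D (graph_hm K D)"
  unfolding continuous_hm_def
proof
  fix f
  have "continuous_on D (\<lambda>x. omega K D x f)"
    using continuous_on_omega closure_subset by (rule continuous_on_subset)
  then show "continuous_on D (\<lambda>x. hm_value D (graph_hm K D) x f)"
    by (rule continuous_on_eq) (simp add: hm_value_def integral_graph_hm)
qed

text \<open>The extension is continuous on \<open>closure D\<close> and equals \<open>f\<close> on
  the boundary, so its values along \<open>X\<close> converge to \<open>f y\<close>.\<close>

lemma regular_hm_graph_hm: "regular_hm G D (graph_hm K D)"
  unfolding regular_hm_def
proof (intro ballI allI impI)
  fix y f and X :: "nat \<Rightarrow> 'a"
  assume y: "y \<in> bdry G D" and X: "range X \<subseteq> D" "X \<longlonglongrightarrow> y"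
  have "y \<in> closure D" "\<And>n. X n \<in> closure D"
    using y X(1) closure_subset[of D] by (auto simp: bdry_eq[OF D(1)])
  then have "(\<lambda>n. omega K D (X n) f) \<longlonglongrightarrow> omega K D y f"
    using continuous_on_tendsto_compose[OF continuous_on_omega X(2)] by simp
  then show "(\<lambda>n. hm_value D (graph_hm K D) (X n) f) \<longlonglongrightarrow> f y"
    using \<open>\<And>n. X n \<in> closure D\<close> by (simp add: hm_value_graph_hm omega_bdry[OF y])
qed

end

section \<open>The family of all domains of the graph\<close>

lemma graph_domainsD:
  assumes "D \<in> graph_domains S K"
  shows "openin (top_of_set G) D" "connected D" "bdry G D \<noteq> {}"
proof -
  have "G \<subseteq> S"
    using embedded unfolding graph_space_def embedded_in_def by blast
  moreover obtain U where "openin (top_of_set S) U" "D = G \<inter> U"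
    using assms unfolding graph_domains_def by blast
  ultimately show "openin (top_of_set G) D"
    using openin_subtopology_Int2 unfolding openin_open by blast
  show "connected D" "bdry G D \<noteq> {}" using assms unfolding graph_domains_def by blast+
qed

lemma compatible_hm_graph_hm: "compatible_hm G (graph_domains S K) (graph_hm K)"
  unfolding compatible_hm_def
proof (intro ballI impI)
  fix D D' f f' x
  assume "D \<in> graph_domains S K" "D' \<in> graph_domains S K"
  note D = graph_domainsD[OF this(1)] and D' = graph_domainsD[OF this(2)]
  assume "\<forall>y\<in>D' \<inter> bdry G D. hm_value D' (graph_hm K D') y f' = f y"
  then have f: "omega K D' y f' = f y" if "y \<in> D'" "y \<in> bdry G D" for y
    using that hm_value_graph_hm[OF D', of y f'] closure_subset[of D'] by auto
  assume "\<forall>y\<in>bdry G D' \<inter> (top_of_set G closure_of D). hm_value D (graph_hm K D) y f = f' y"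
  then have f': "omega K D y f = f' y" if "y \<in> bdry G D'" "y \<in> closure D" for y
    using that hm_value_graph_hm[OF D, of y f] by (simp add: closure_of_eq[OF D(1)])
  assume x: "x \<in> D \<inter> D'"
  have W: "openin (top_of_set G) (D \<inter> D')" "D \<inter> D' \<noteq> G"
    using D(1) D'(1) domain_neq_G[OF D] openin_subset_G[OF D(1)] by auto
  have cl: "closure (D \<inter> D') \<subseteq> closure D" "closure (D \<inter> D') \<subseteq> closure D'"
    by (auto intro: closure_mono[THEN subsetD])
  \<comment> \<open>A boundary point of the intersection that lies in \<open>D'\<close> is a
    boundary point of \<open>D\<close>; otherwise it is a boundary point of \<open>D'\<close> in
    \<open>closure D\<close>. The two compatibility assumptions cover exactly these cases.\<close>
  have bd: "omega K D y f = omega K D' y f'" if y: "y \<in> bdry G (D \<inter> D')" for y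
  proof (cases "y \<in> D'")
    case True
    then have "y \<in> bdry G D" using y cl unfolding bdry_eq[OF W(1)] bdry_eq[OF D(1)] by blast
    then show ?thesis using f[OF True] omega_bdry[OF D] by simp
  next
    case False
    then have "y \<in> bdry G D'" "y \<in> closure D"
      using y cl unfolding bdry_eq[OF W(1)] bdry_eq[OF D'(1)] by blast+
    then show ?thesis using f' omega_bdry[OF D'] by simp
  qed
  have cont: "continuous_on (closure (D \<inter> D')) (\<lambda>x. omega K D x f)"
    "continuous_on (closure (D \<inter> D')) (\<lambda>x. omega K D' x f')"
    using continuous_on_subset[OF continuous_on_omega[OF D] cl(1)]
      continuous_on_subset[OF continuous_on_omega[OF D'] cl(2)] by auto
  have "omega K D x f - omega K D' x f' \<le> 0"
    by (rule weak_maximum_principle[OF W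
          locally_harmonic_diff[OF locally_harmonic_omega[OF D] locally_harmonic_omega[OF D']]])
      (use bd x cont in \<open>auto intro!: continuous_intros\<close>)
  moreover have "omega K D' x f' - omega K D x f \<le> 0"
    by (rule weak_maximum_principle[OF W
          locally_harmonic_diff[OF locally_harmonic_omega[OF D'] locally_harmonic_omega[OF D],
            unfolded Int_commute[of D' D]]])
      (use bd x cont in \<open>auto intro!: continuous_intros\<close>)
  ultimately have "omega K D x f = omega K D' x f'" by simp
  then show "hm_value D (graph_hm K D) x f = hm_value D' (graph_hm K D') x f'"
    using x integral_graph_hm[OF D] integral_graph_hm[OF D'] by (simp add: hm_value_def)
qed

lemma omega_constant_on:
  assumes "D \<in> graph_domains S K" and x0: "x0 \<in> D" "omega K D x0 f = (SUP x\<in>D. omega K D x f)"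
  shows "(\<lambda>x. omega K D x f) constant_on D"
proof -
  note D = graph_domainsD[OF assms(1)]
  \<comment> \<open>A real supremum is an upper bound only for a bounded set; the continuous
    extension to the compact closure supplies the bound.\<close>
  have "compact ((\<lambda>x. omega K D x f) ` closure D)"
    by (intro compact_continuous_image continuous_on_omega[OF D] compact_closure_W[OF D(1)])
  then have "bdd_above ((\<lambda>x. omega K D x f) ` D)"
    by (meson bdd_above_mono bounded_imp_bdd_above closure_subset compact_imp_bounded image_mono)
  then have "omega K D x f \<le> omega K D x0 f" if "x \<in> D" for x
    unfolding x0(2) using that by (rule cSUP_upper[rotated])
  then have "omega K D x f = omega K D x0 f" if "x \<in> D" for x
    using omega_strong_maximum[OF D x0(1)] that by blast
  then show ?thesis unfolding constant_on_def by blast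
qed

end

theorem theorem3p7:
  fixes S :: "'a::euclidean_space set" and K :: "'a embedded_graph"
  assumes "compact_surface S"
    and "finite_connected_weighted_graph K"
    and "embedded_in K S"
  shows "((\<forall>D\<in>graph_domains S K. \<forall>f. f \<in> hm_functions D (graph_hm K D) \<and>
             (\<forall>x\<in>D. integral\<^sup>L (graph_hm K D x) f = omega K D x f)) \<and>
          harmonic_measure_system (graph_space K) (graph_domains S K) (graph_hm K)) \<and>
         (\<forall>D\<in>graph_domains S K. regular_hm (graph_space K) D (graph_hm K D)) \<and>
         regular_closed_hm (graph_space K) (graph_domains S K) (graph_hm K) \<and>
         (\<forall>D\<in>graph_domains S K. \<forall>f. \<forall>x\<^sub>0\<in>D.
            omega K D x\<^sub>0 f = (SUP x\<in>D. omega K D x f) \<longrightarrow>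
            (\<lambda>x. omega K D x f) constant_on D)"
proof -
  interpret embedded_network K S using assms by unfold_locales
  have regular: "regular_hm G D (graph_hm K D)" if "D \<in> graph_domains S K" for D
    using regular_hm_graph_hm[OF graph_domainsD[OF that]] .
  have "regular_closed_hm G (graph_domains S K) (graph_hm K)"
    unfolding regular_closed_hm_def
  proof
    fix D assume "D \<in> graph_domains S K"
    then show "\<exists>U::nat \<Rightarrow> 'a set. incseq U \<and> (\<Union>n. U n) = D \<and>
        (\<forall>n. U n \<in> graph_domains S K \<and> regular_hm G (U n) (graph_hm K (U n)))"
      using regular by (intro exI[of _ "\<lambda>_. D"]) (simp add: incseq_const)
  qed
  moreover have "harmonic_measure_system G (graph_domains S K) (graph_hm K)"
    unfolding harmonic_measure_system_def
    using harmonic_measure_graph_hm[OF graph_domainsD] continuous_hm_graph_hm[OF graph_domainsD]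
      compatible_hm_graph_hm by blast
  moreover have "f \<in> hm_functions D (graph_hm K D)"
    "\<forall>x\<in>D. integral\<^sup>L (graph_hm K D x) f = omega K D x f" if "D \<in> graph_domains S K" for D f
    using hm_functions_graph_hm[OF graph_domainsD[OF that]]
      integral_graph_hm[OF graph_domainsD[OF that]] by auto
  ultimately show ?thesis
    using regular omega_constant_on by blast
qed

end
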